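(* Let $\alpha_0\in[0,1)$, $\beta>0$, $\mu_0\ge0$, $\Delta\mu>0$. For $\eta\in[0,1]$ let $\alpha_\eta(x)=\alpha_0(1-\eta x^2)$, $x\in[0,1]$, and for $T>0$ let $(N^{+}_t,N^{-}_t)_{t\in[0,T]}$ (depending on $\eta$ and $T$) be the bivariate locally stationary Hawkes process with intensities $$\lambda^{+}_t=\mu_0+\Delta\mu+\int_{[0,t)}\alpha_\eta\big(\tfrac tT\big)\,\beta e^{-\beta(t-s)}\,dN^{-}_s,\qquad \lambda^{-}_t=\mu_0+\int_{[0,t)}\alpha_\eta\big(\tfrac tT\big)\,\beta e^{-\beta(t-s)}\,dN^{+}_s,$$ and let $P^\eta_t=N^+_t-N^-_t$. Then for every $u\in(0,1]$ and every $\eta\in[0,1]$, $$\frac{\mathbb E\big[P^\eta_{Tu}-P^\eta_0\big]}{\mathbb E\big[P^0_{Tu}-P^0_0\big]}\longrightarrow\frac{\operatorname{atanh}(\sqrt{\zeta_0}\,u)}{\sqrt{\zeta_0}\,u}\qquad\text{as }T\to\infty,$$ where $\zeta_0=\alpha_0\eta(1+\alpha_0)^{-1}$, $P^0$ is the process $P^\eta$ for $\eta=0$ (with the same $\mu_0,\Delta\mu,\alpha_0,\beta$), and the right-hand side is read as $1$ when $\zeta_0=0$.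
   Context: A bivariate locally stationary Hawkes process with the intensities $(\lambda^+,\lambda^-)$ is constructed from two independent unit-intensity Poisson random measures $\pi_+,\pi_-$ on $\mathbb R^2$ by $N^{\pm}_t=\int_0^t\int_0^\infty\mathbf 1_{\{x\le\lambda^{\pm}_s\}}\pi_{\pm}(dx,ds)$, with $N^\pm_0=0$; the intensities depend only on the past jumps, so the system is recursively well defined. *)

theory Defs
  imports "HOL-Probability.Probability"
begin

(* Sets of infinite intensity need no separate clause: for sigma-finite nu (here Lebesgue measure),
   the remaining conditions already force infinitely many points on them almost surely. *)
locale poisson_random_measure = prob_space M
  for M :: "'a measure" +
  fixes \<nu> :: "'b measure" and \<pi> :: "'a \<Rightarrow> 'b measure"
  assumes sets_eq: "\<omega> \<in> space M \<Longrightarrow> sets (\<pi> \<omega>) = sets \<nu>"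
    and integer_valued:
      "\<omega> \<in> space M \<Longrightarrow> A \<in> sets \<nu> \<Longrightarrow> emeasure (\<pi> \<omega>) A \<in> range ennreal_of_enat"
    and count_measurable:
      "A \<in> sets \<nu> \<Longrightarrow> (\<lambda>\<omega>. emeasure (\<pi> \<omega>) A) \<in> borel_measurable M"
    and poisson_counts:
      "A \<in> sets \<nu> \<Longrightarrow> emeasure \<nu> A < \<infinity> \<Longrightarrow>
        prob {\<omega> \<in> space M. emeasure (\<pi> \<omega>) A = of_nat k} =
          exp (- measure \<nu> A) * measure \<nu> A ^ k / fact k"
    and independent_counts:
      "range D \<subseteq> sets \<nu> \<Longrightarrow> disjoint_family D \<Longrightarrow>
        indep_vars (\<lambda>_. borel) (\<lambda>n \<omega>. emeasure (\<pi> \<omega>) (D n)) (UNIV :: nat set)"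

definition indep_random_measures ::
    "'a measure \<Rightarrow> 'b measure \<Rightarrow> ('a \<Rightarrow> 'b measure) \<Rightarrow> ('a \<Rightarrow> 'b measure) \<Rightarrow> bool" where
  "indep_random_measures M \<nu> \<pi>\<^sub>1 \<pi>\<^sub>2 \<longleftrightarrow>
    prob_space.indep_var M
      (\<Pi>\<^sub>M A\<in>sets \<nu>. borel) (\<lambda>\<omega>. \<lambda>A\<in>sets \<nu>. emeasure (\<pi>\<^sub>1 \<omega>) A)
      (\<Pi>\<^sub>M A\<in>sets \<nu>. borel) (\<lambda>\<omega>. \<lambda>A\<in>sets \<nu>. emeasure (\<pi>\<^sub>2 \<omega>) A)"

(* The Lebesgue-Stieltjes measure dN of a path on [0,T]. The path is extended by constants outside
   [0,T] because interval_measure needs a distribution function on the whole line; so dN does not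
   charge the complement of (0,T]. *)
definition path_measure :: "real \<Rightarrow> (real \<Rightarrow> nat) \<Rightarrow> real measure" where
  "path_measure T n = interval_measure (\<lambda>s. real (n (max 0 (min T s))))"

definition intensity ::
    "real \<Rightarrow> (real \<Rightarrow> real) \<Rightarrow> real \<Rightarrow> real \<Rightarrow> (real \<Rightarrow> nat) \<Rightarrow> real \<Rightarrow> real" where
  "intensity \<mu> \<alpha> \<beta> T n t =
    \<mu> + (LINT s:{0..<t}|path_measure T n. \<alpha> (t / T) * (\<beta> * exp (- \<beta> * (t - s))))"

(* Points of the driving measures are pairs (x, s): mark x first, time s second. *)
definition thinning_region :: "(real \<Rightarrow> real) \<Rightarrow> real \<Rightarrow> (real \<times> real) set" where
  "thinning_region l t = {(x, s). 0 \<le> x \<and> x \<le> l s \<and> 0 < s \<and> s \<le> t}"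

(* The two processes are specified by the joint thinning equations, which almost surely have a unique
   solution. Non-explosion on [0,T] is enforced by the type nat: all counts are finite.
   The initial condition N_0 = 0 (a.s.) is the case t = 0, where the thinning region is empty. *)
definition locally_stationary_hawkes ::
    "'a measure \<Rightarrow> ('a \<Rightarrow> (real \<times> real) measure) \<Rightarrow> ('a \<Rightarrow> (real \<times> real) measure) \<Rightarrow>
     real \<Rightarrow> real \<Rightarrow> (real \<Rightarrow> real) \<Rightarrow> real \<Rightarrow> real \<Rightarrow>
     (real \<Rightarrow> 'a \<Rightarrow> nat) \<Rightarrow> (real \<Rightarrow> 'a \<Rightarrow> nat) \<Rightarrow> bool" where
  "locally_stationary_hawkes M \<pi>p \<pi>m \<mu>p \<mu>m \<alpha> \<beta> T Np Nm \<longleftrightarrow>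
    (\<forall>t\<in>{0..T}. Np t \<in> measurable M (count_space UNIV)) \<and>
    (\<forall>t\<in>{0..T}. Nm t \<in> measurable M (count_space UNIV)) \<and>
    (AE \<omega> in M. \<forall>t\<in>{0..T}.
      of_nat (Np t \<omega>) =
        emeasure (\<pi>p \<omega>) (thinning_region (intensity \<mu>p \<alpha> \<beta> T (\<lambda>s. Nm s \<omega>)) t) \<and>
      of_nat (Nm t \<omega>) =
        emeasure (\<pi>m \<omega>) (thinning_region (intensity \<mu>m \<alpha> \<beta> T (\<lambda>s. Np s \<omega>)) t))"

definition price :: "(real \<Rightarrow> 'a \<Rightarrow> nat) \<Rightarrow> (real \<Rightarrow> 'a \<Rightarrow> nat) \<Rightarrow> real \<Rightarrow> 'a \<Rightarrow> real" where
  "price Np Nm t \<omega> = real (Np t \<omega>) - real (Nm t \<omega>)"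

end

(* On a grid of mesh h, replace the intensities in each slab (k h, (k+1) h] by the constant obtained
   from the counts of the previous slabs, rounding all elapsed times up. As the kernel decreases, the
   resulting counts are dominated by the Hawkes process. The scheme involves only countably many
   histories, so independence of the Poisson counts of disjoint sets gives the mean number of points
   of any history-dependent region, and hence an explicit linear recursion for the mean counts. The
   same formula shows that almost surely no point lies on the graph of the limiting intensity;
   together with the integrality of the paths this forces the scheme to coincide with the process
   at the horizon once h is small. So the mean price is the limit of the recursion.

   The recursion discretises y' = beta (Dmu - (1 + a) y), D' = Dmu - a y, with a = alpha(t/T). With
   g = a / (1 + a) one has (D - g y / beta)' = Dmu / (1 + a) + O(1/T), so E P_{Tu} differs from
   T Dmu * int_0^u dx / (1 + alpha(x)) by a bounded amount, and the integral is
   artanh(sqrt zeta u) / (sqrt zeta (1 + alpha_0)). *)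
theory Submission
  imports Defs
begin

section \<open>Counts of Poisson random measures\<close>

text \<open>The obstacle: N+ and N- are given only as measurable counts that solve the thinning
  equations almost surely. Nothing says that the intensity at s is a function of the points before
  s, so E N = E (integral of the intensity) cannot be invoked for them directly. The scheme is a
  function of counts in earlier slabs by construction, so for it this identity is an independence
  statement; the rest of the comparison with the true process is pathwise. Rounding in one direction
  gives domination by induction over slabs, and with it a majorant, N at the horizon, for the
  passage to the limit. Its price is that a point lying exactly on the graph of the intensity may
  never be caught by boxes of smaller height; hence the separate argument excluding such points. The
  error stays bounded in T for two reasons: the mean difference y remains in [0, Dmu] whatever the
  horizon, and alpha(t/T) is monotone, slowly varying, and changes by a bounded amount in total over
  [0, T].\<close>

definition num_points :: "'b measure \<Rightarrow> 'b set \<Rightarrow> nat" where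
  "num_points m A = nat \<lfloor>measure m A\<rfloor>"

lemma num_points_eq: "emeasure m A = of_nat k \<Longrightarrow> num_points m A = k"
  by (simp add: num_points_def measure_def)

text \<open>\<open>num_points\<close> reads an infinite measure as 0, so it is faithful only where
  finiteness has been secured.\<close>

lemma emeasure_eq_num_points:
  assumes "emeasure m A \<in> range ennreal_of_enat" "emeasure m A < \<infinity>"
  shows "emeasure m A = of_nat (num_points m A)"
proof -
  obtain e where "emeasure m A = ennreal_of_enat e" using assms(1) by auto
  with assms(2) obtain k where "emeasure m A = of_nat k" by (cases e) auto
  then show ?thesis using num_points_eq by metis
qed

context poisson_random_measure
begin

text \<open>The Poisson weights already sum to 1 over the finite values, which leaves probability 0
  for infinity.\<close>

lemma AE_emeasure_finite:
  assumes A: "A \<in> sets \<nu>" "emeasure \<nu> A < \<infinity>"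
  shows "AE \<omega> in M. emeasure (\<pi> \<omega>) A = of_nat (num_points (\<pi> \<omega>) A)"
proof -
  note [measurable] = count_measurable[OF A(1)]
  let ?E = "\<lambda>k. {\<omega> \<in> space M. emeasure (\<pi> \<omega>) A = of_nat k}"
  have "(\<lambda>k. measure \<nu> A ^ k / fact k) sums exp (measure \<nu> A)"
    using exp_converges[of "measure \<nu> A"] by (simp add: scaleR_conv_of_real divide_inverse mult.commute)
  then have "(\<lambda>k. exp (- measure \<nu> A) * (measure \<nu> A ^ k / fact k)) sums (exp (- measure \<nu> A) * exp (measure \<nu> A))"
    by (rule sums_mult)
  then have "(\<lambda>k. prob (?E k)) sums 1"
    by (simp add: poisson_counts[OF A] flip: exp_add)
  moreover have "(\<lambda>k. prob (?E k)) sums prob (\<Union>k. ?E k)"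
    by (intro finite_measure_UNION) (auto simp: disjoint_family_on_def)
  ultimately have "1 = prob (\<Union>k. ?E k)"
    by (rule sums_unique2)
  then have "prob (\<Union>k. ?E k) = 1" by (rule sym)
  then have "AE \<omega> in M. \<omega> \<in> (\<Union>k. ?E k)"
    by (subst (asm) prob_eq_1) auto
  then show ?thesis
    by eventually_elim (use num_points_eq in fastforce)
qed

lemma num_points_measurable [measurable]:
  assumes "A \<in> sets \<nu>"
  shows "(\<lambda>\<omega>. num_points (\<pi> \<omega>) A) \<in> measurable M (count_space UNIV)"
  using count_measurable[OF assms] unfolding num_points_def measure_def by measurable

lemma nn_integral_emeasure:
  assumes A: "A \<in> sets \<nu>" "emeasure \<nu> A < \<infinity>"
  shows "(\<integral>\<^sup>+\<omega>. emeasure (\<pi> \<omega>) A \<partial>M) = emeasure \<nu> A"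
proof -
  note [measurable] = count_measurable[OF A(1)] num_points_measurable[OF A(1)]
  define m where "m = measure \<nu> A"
  let ?E = "\<lambda>k. {\<omega> \<in> space M. emeasure (\<pi> \<omega>) A = of_nat k}"
  have m0: "0 \<le> m" by (simp add: m_def)
  have "(\<integral>\<^sup>+\<omega>. emeasure (\<pi> \<omega>) A \<partial>M)
      = (\<integral>\<^sup>+\<omega>. (\<Sum>k. of_nat k * indicator (?E k) \<omega>) \<partial>M)"
  proof (rule nn_integral_cong_AE)
    have "(\<Sum>k. of_nat k * indicator (?E k) \<omega>) = (of_nat n :: ennreal)"
      if "emeasure (\<pi> \<omega>) A = of_nat n" "\<omega> \<in> space M" for n \<omega>
      using that suminf_finite[of "{n}" "\<lambda>k. of_nat k * indicator (?E k) \<omega> :: ennreal"]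
      by (auto simp: indicator_def)
    then show "AE \<omega> in M. emeasure (\<pi> \<omega>) A = (\<Sum>k. of_nat k * indicator (?E k) \<omega>)"
      using AE_emeasure_finite[OF A] by (auto elim!: AE_mp simp del: of_nat_eq_iff)
  qed
  also have "\<dots> = (\<Sum>k. of_nat k * emeasure M (?E k))"
    by (subst nn_integral_suminf) (auto simp: nn_integral_cmult)
  also have "\<dots> = (\<Sum>k. ennreal (of_nat k * (exp (- m) * m ^ k / fact k)))"
    unfolding emeasure_eq_measure poisson_counts[OF A] m_def[symmetric]
    by (simp add: ennreal_mult' m0 ennreal_of_nat_eq_real_of_nat flip: times_divide_eq_right)
  also have "\<dots> = ennreal m"
  proof (rule sums_unique[symmetric])
    have "(\<lambda>k. m ^ k / fact k) sums exp m"
      using exp_converges[of m] by (simp add: scaleR_conv_of_real divide_inverse mult.commute)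
    then have "(\<lambda>k. (m * exp (- m)) * (m ^ k / fact k)) sums ((m * exp (- m)) * exp m)"
      by (rule sums_mult)
    also have "(m * exp (- m)) * exp m = m" by (simp flip: exp_add)
    \<comment> \<open>k times the k-th Poisson weight is m times the previous weight, and the term
      for k = 0 vanishes.\<close>
    also have "(\<lambda>k. (m * exp (- m)) * (m ^ k / fact k)) = (\<lambda>k. of_nat (Suc k) * (exp (- m) * m ^ Suc k / fact (Suc k)))"
      by (auto simp: fun_eq_iff field_simps simp del: of_nat_Suc)
    finally have "(\<lambda>k. real k * (exp (- m) * m ^ k / fact k)) sums m"
      by (subst (asm) sums_Suc_iff) simp
    then show "(\<lambda>k. ennreal (real k * (exp (- m) * m ^ k / fact k))) sums ennreal m"
      by (subst sums_ennreal) (use m0 in auto)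
  qed
  also have "\<dots> = emeasure \<nu> A"
    using A(2) by (simp add: m_def emeasure_eq_ennreal_measure less_top)
  finally show ?thesis .
qed

text \<open>The history event and the last count are functions of counts of disjoint sets, so the
  expectation of the product factorises.\<close>

lemma nn_integral_indep_counts:
  fixes D :: "nat \<Rightarrow> 'b set" and c :: "nat \<Rightarrow> nat"
  assumes D: "\<And>j. j \<le> k \<Longrightarrow> D j \<in> sets \<nu>" "disjoint_family_on D {..k}"
    and fin: "emeasure \<nu> (D k) < \<infinity>"
  shows "(\<integral>\<^sup>+\<omega>. indicator {\<omega>. \<forall>j<k. num_points (\<pi> \<omega>) (D j) = c j} \<omega> * emeasure (\<pi> \<omega>) (D k) \<partial>M)
     = (\<integral>\<^sup>+\<omega>. indicator {\<omega>. \<forall>j<k. num_points (\<pi> \<omega>) (D j) = c j} \<omega> \<partial>M) * emeasure \<nu> (D k)"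
proof -
  \<comment> \<open>Independence is given for infinite sequences, so the finite family is padded
    with empty sets. \<open>g\<close> turns the earlier coordinates into indicators and keeps the
    last one as a count.\<close>
  define D' where "D' j = (if j \<le> k then D j else {})" for j
  define g :: "nat \<Rightarrow> ennreal \<Rightarrow> ennreal" where
    "g j x = (if j < k then indicator {x. nat \<lfloor>enn2real x\<rfloor> = c j} x else x)" for j x
  have [measurable]: "g j \<in> borel_measurable borel" for j
    by (cases "j < k") (auto simp: g_def[abs_def])
  have "indep_vars (\<lambda>_. borel) (\<lambda>n \<omega>. emeasure (\<pi> \<omega>) (D' n)) (UNIV :: nat set)"
    using D by (intro independent_counts) (auto simp: D'_def disjoint_family_on_def)
  then have "indep_vars (\<lambda>_. borel) (\<lambda>n \<omega>. g n (emeasure (\<pi> \<omega>) (D' n))) UNIV"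
    by (rule indep_vars_compose2) simp
  then have ind: "indep_vars (\<lambda>_. borel) (\<lambda>n \<omega>. g n (emeasure (\<pi> \<omega>) (D' n))) I" for I
    by (rule indep_vars_subset) simp
  have prod: "(\<Prod>j<k. g j (emeasure (\<pi> \<omega>) (D' j)))
      = indicator {\<omega>. \<forall>j<k. num_points (\<pi> \<omega>) (D j) = c j} \<omega>" for \<omega>
    by (auto simp: indicator_def g_def D'_def num_points_def measure_def)
  have "(\<integral>\<^sup>+\<omega>. indicator {\<omega>. \<forall>j<k. num_points (\<pi> \<omega>) (D j) = c j} \<omega> * emeasure (\<pi> \<omega>) (D k) \<partial>M)
      = (\<integral>\<^sup>+\<omega>. (\<Prod>j\<in>{..<Suc k}. g j (emeasure (\<pi> \<omega>) (D' j))) \<partial>M)"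
    by (simp add: prod) (simp add: g_def D'_def)
  also have "\<dots> = (\<Prod>j\<in>{..<Suc k}. (\<integral>\<^sup>+\<omega>. g j (emeasure (\<pi> \<omega>) (D' j)) \<partial>M))"
    by (rule indep_vars_nn_integral) (auto intro: ind)
  also have "\<dots> = (\<Prod>j\<in>{..<k}. (\<integral>\<^sup>+\<omega>. g j (emeasure (\<pi> \<omega>) (D' j)) \<partial>M)) * (\<integral>\<^sup>+\<omega>. emeasure (\<pi> \<omega>) (D k) \<partial>M)"
    by (simp add: g_def D'_def)
  also have "(\<Prod>j\<in>{..<k}. (\<integral>\<^sup>+\<omega>. g j (emeasure (\<pi> \<omega>) (D' j)) \<partial>M))
      = (\<integral>\<^sup>+\<omega>. (\<Prod>j\<in>{..<k}. g j (emeasure (\<pi> \<omega>) (D' j))) \<partial>M)"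
    by (rule indep_vars_nn_integral[symmetric]) (auto intro: ind)
  also have "(\<integral>\<^sup>+\<omega>. emeasure (\<pi> \<omega>) (D k) \<partial>M) = emeasure \<nu> (D k)"
    by (rule nn_integral_emeasure) (use D fin in auto)
  finally show ?thesis by (simp add: prod)
qed

end

lemma (in prob_space) indep_var_nn_integral_mult:
  fixes F G :: "'b \<Rightarrow> ennreal"
  assumes "indep_var S X S' X'" "F \<in> borel_measurable S" "G \<in> borel_measurable S'"
  shows "(\<integral>\<^sup>+\<omega>. F (X \<omega>) * G (X' \<omega>) \<partial>M) = (\<integral>\<^sup>+\<omega>. F (X \<omega>) \<partial>M) * (\<integral>\<^sup>+\<omega>. G (X' \<omega>) \<partial>M)"
proof -
  have "indep_var borel (F \<circ> X) borel (G \<circ> X')"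
    using assms by (rule indep_var_compose)
  moreover have "case_bool borel borel = (\<lambda>_. borel :: ennreal measure)"
    by (auto split: bool.split)
  ultimately have "indep_vars (\<lambda>_. borel) (case_bool (F \<circ> X) (G \<circ> X')) UNIV"
    by (simp only: indep_var_def)
  then have "(\<integral>\<^sup>+\<omega>. (\<Prod>b\<in>UNIV. case_bool (F \<circ> X) (G \<circ> X') b \<omega>) \<partial>M)
      = (\<Prod>b\<in>UNIV. \<integral>\<^sup>+\<omega>. case_bool (F \<circ> X) (G \<circ> X') b \<omega> \<partial>M)"
    by (intro indep_vars_nn_integral) auto
  then show ?thesis by (simp add: UNIV_bool mult.commute comp_def)
qed

text \<open>Independence of the two measures splits off the event of the second one, the previous
  lemma separates the last count of the first from its history, and the two events are then joined
  again.\<close>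

lemma nn_integral_indep_two_counts:
  fixes D D' :: "nat \<Rightarrow> 'b set" and c c' :: "nat \<Rightarrow> nat"
  assumes "poisson_random_measure M \<nu> \<pi>" "poisson_random_measure M \<nu> \<pi>'"
    and ind: "indep_random_measures M \<nu> \<pi> \<pi>'"
    and D: "\<And>j. j \<le> k \<Longrightarrow> D j \<in> sets \<nu>" "disjoint_family_on D {..k}" "emeasure \<nu> (D k) < \<infinity>"
    and D': "\<And>j. j < k \<Longrightarrow> D' j \<in> sets \<nu>"
  shows "(\<integral>\<^sup>+\<omega>. indicator {\<omega>. \<forall>j<k. num_points (\<pi> \<omega>) (D j) = c j} \<omega> *
       indicator {\<omega>. \<forall>j<k. num_points (\<pi>' \<omega>) (D' j) = c' j} \<omega> * emeasure (\<pi> \<omega>) (D k) \<partial>M)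
     = (\<integral>\<^sup>+\<omega>. indicator {\<omega>. \<forall>j<k. num_points (\<pi> \<omega>) (D j) = c j} \<omega> *
       indicator {\<omega>. \<forall>j<k. num_points (\<pi>' \<omega>) (D' j) = c' j} \<omega> \<partial>M) * emeasure \<nu> (D k)"
proof -
  interpret p: poisson_random_measure M \<nu> \<pi> by fact
  define S where "S = (\<Pi>\<^sub>M A\<in>sets \<nu>. (borel :: ennreal measure))"
  define X X' where "X \<omega> = (\<lambda>A\<in>sets \<nu>. emeasure (\<pi> \<omega>) A)"
    and "X' \<omega> = (\<lambda>A\<in>sets \<nu>. emeasure (\<pi>' \<omega>) A)" for \<omega>
  have iv: "p.indep_var S X S X'"
    using ind by (simp add: indep_random_measures_def S_def X_def[abs_def] X'_def[abs_def])
  \<comment> \<open>Independence of the measures is stated for the maps sending a set to its count;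
    \<open>J\<close> expresses a history event as a function of finitely many coordinates of such a
    map.\<close>
  define J where "J E e v = (indicator {v. \<forall>j<k. nat \<lfloor>enn2real (v (E j))\<rfloor> = e j} v :: ennreal)"
    for E :: "nat \<Rightarrow> 'b set" and e :: "nat \<Rightarrow> nat" and v
  have comp: "(\<lambda>v. v A) \<in> borel_measurable S" if "A \<in> sets \<nu>" for A
    using that unfolding S_def by measurable
  have J: "J E e \<in> borel_measurable S" if "\<And>j. j < k \<Longrightarrow> E j \<in> sets \<nu>" for E e
  proof -
    have "J E e v = (\<Prod>j<k. indicator {x. nat \<lfloor>enn2real x\<rfloor> = e j} (v (E j)))" for v
      by (auto simp: J_def indicator_def)
    moreover have "(\<lambda>v. indicator {x. nat \<lfloor>enn2real x\<rfloor> = e j} (v (E j)) :: ennreal) \<in> borel_measurable S"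
      if "j < k" for j
      using comp[OF \<open>\<And>j. j < k \<Longrightarrow> E j \<in> sets \<nu>\<close>[OF that]] by measurable
    ultimately show ?thesis
      by (subst measurable_cong[where g="\<lambda>v. \<Prod>j<k. indicator {x. nat \<lfloor>enn2real x\<rfloor> = e j} (v (E j))"])
        (auto intro!: borel_measurable_prod_ennreal)
  qed
  have JX: "J D c (X \<omega>) = indicator {\<omega>. \<forall>j<k. num_points (\<pi> \<omega>) (D j) = c j} \<omega>"
    and JX': "J D' c' (X' \<omega>) = indicator {\<omega>. \<forall>j<k. num_points (\<pi>' \<omega>) (D' j) = c' j} \<omega>"
    and XD: "X \<omega> (D k) = emeasure (\<pi> \<omega>) (D k)" for \<omega>
    using D(1) D'
    by (auto simp: J_def indicator_def X_def X'_def num_points_def measure_def less_imp_le)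
  have JD0: "J D c \<in> borel_measurable S" and JD': "J D' c' \<in> borel_measurable S"
    using D(1) D' by (auto intro!: J)
  have JD: "(\<lambda>v. J D c v * v (D k)) \<in> borel_measurable S"
    by (rule borel_measurable_times_ennreal[OF JD0 comp[OF D(1)[OF order_refl]]])
  have "(\<integral>\<^sup>+\<omega>. J D c (X \<omega>) * J D' c' (X' \<omega>) * X \<omega> (D k) \<partial>M)
      = (\<integral>\<^sup>+\<omega>. (J D c (X \<omega>) * X \<omega> (D k)) * J D' c' (X' \<omega>) \<partial>M)"
    by (simp add: mult_ac)
  also have "\<dots> = (\<integral>\<^sup>+\<omega>. J D c (X \<omega>) * X \<omega> (D k) \<partial>M) * (\<integral>\<^sup>+\<omega>. J D' c' (X' \<omega>) \<partial>M)"
    by (rule p.indep_var_nn_integral_mult[OF iv JD JD'])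
  also have "(\<integral>\<^sup>+\<omega>. J D c (X \<omega>) * X \<omega> (D k) \<partial>M) = (\<integral>\<^sup>+\<omega>. J D c (X \<omega>) \<partial>M) * emeasure \<nu> (D k)"
    unfolding JX XD using D by (rule p.nn_integral_indep_counts)
  also have "\<dots> * (\<integral>\<^sup>+\<omega>. J D' c' (X' \<omega>) \<partial>M)
      = ((\<integral>\<^sup>+\<omega>. J D c (X \<omega>) \<partial>M) * (\<integral>\<^sup>+\<omega>. J D' c' (X' \<omega>) \<partial>M)) * emeasure \<nu> (D k)"
    by (simp add: mult_ac)
  also have "(\<integral>\<^sup>+\<omega>. J D c (X \<omega>) \<partial>M) * (\<integral>\<^sup>+\<omega>. J D' c' (X' \<omega>) \<partial>M) = (\<integral>\<^sup>+\<omega>. J D c (X \<omega>) * J D' c' (X' \<omega>) \<partial>M)"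
    by (rule p.indep_var_nn_integral_mult[OF iv JD0 JD', symmetric])
  finally show ?thesis unfolding JX JX' XD .
qed

section \<open>History-dependent thinning regions\<close>

text \<open>Cross-excitation: the region examined by one measure is selected by the counts of the
  other. The lists are chronological, so their length is the number of the current slab.\<close>

primrec hist :: "(nat list \<Rightarrow> 'b set) \<Rightarrow> (nat list \<Rightarrow> 'b set) \<Rightarrow> 'b measure \<Rightarrow> 'b measure
    \<Rightarrow> nat \<Rightarrow> nat list \<times> nat list" where
  "hist B B' m m' 0 = ([], [])"
| "hist B B' m m' (Suc k) = (let (c, c') = hist B B' m m' k in (c @ [num_points m (B c')], c' @ [num_points m' (B' c)]))"

lemma hist_swap: "hist B' B m' m k = prod.swap (hist B B' m m' k)"
  by (induction k) (auto simp: Let_def split: prod.splits)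

lemma length_hist [simp]:
  "length (fst (hist B B' m m' k)) = k" "length (snd (hist B B' m m' k)) = k"
  by (induction k) (auto simp: Let_def split: prod.splits)

text \<open>Once the pair of lists is prescribed, every region visited by the recursion is
  deterministic, so the event is a conjunction about counts of fixed sets.\<close>

lemma hist_eq_iff:
  "hist B B' m m' k = (c, c') \<longleftrightarrow> length c = k \<and> length c' = k \<and>
     (\<forall>j<k. num_points m (B (take j c')) = c ! j) \<and> (\<forall>j<k. num_points m' (B' (take j c)) = c' ! j)"
proof (induction k arbitrary: c c')
  case 0
  then show ?case by auto
next
  case (Suc k)
  show ?case
  proof (cases "length c = Suc k \<and> length c' = Suc k")
    case False
    then show ?thesis using length_hist[of B B' m m' "Suc k"] by (metis fst_conv snd_conv)
  next
    case True
    then obtain d x d' x' where c: "c = d @ [x]" "c' = d' @ [x']" "length d = k" "length d' = k"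
      by (metis length_Suc_conv_rev)
    have "hist B B' m m' (Suc k) = (c, c') \<longleftrightarrow>
        hist B B' m m' k = (d, d') \<and> num_points m (B d') = x \<and> num_points m' (B' d) = x'"
      by (auto simp: c Let_def split: prod.splits)
    also have "\<dots> \<longleftrightarrow> (\<forall>j<Suc k. num_points m (B (take j c')) = c ! j) \<and> (\<forall>j<Suc k. num_points m' (B' (take j c)) = c' ! j)"
      unfolding Suc.IH using c(3,4) by (auto simp: c nth_append less_Suc_eq all_conj_distrib)
    finally show ?thesis using True by simp
  qed
qed

lemma (in prob_space) indep_var_swap:
  assumes "indep_var S X T Y"
  shows "indep_var T Y S X"
  using assms unfolding indep_var_eq indep_sets2_eq
  by (elim conjE, intro conjI ballI) (assumption | subst Int_commute, subst mult.commute, blast)+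

locale independent_prms =
  p: poisson_random_measure M \<nu> \<pi> + p': poisson_random_measure M \<nu> \<pi>'
  for M :: "'a measure" and \<nu> :: "'b measure" and \<pi> \<pi>' +
  assumes indep: "indep_random_measures M \<nu> \<pi> \<pi>'"
begin

lemma independent_prms_swap: "independent_prms M \<nu> \<pi>' \<pi>"
proof
  show "indep_random_measures M \<nu> \<pi>' \<pi>"
    using indep unfolding indep_random_measures_def by (rule p.indep_var_swap)
qed

end

text \<open>Tying each region to the slab numbered by the length of the history makes the regions
  along any single history disjoint, as independent counts require.\<close>

locale prm_scheme = independent_prms M \<nu> \<pi> \<pi>'
  for M :: "'a measure" and \<nu> :: "'b measure" and \<pi> \<pi>' +
  fixes slab :: "nat \<Rightarrow> 'b set" and B B' :: "nat list \<Rightarrow> 'b set"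
  assumes disjoint_slab: "disjoint_family slab"
    and B: "B c \<in> sets \<nu>" "B c \<subseteq> slab (length c)"
    and B': "B' c \<in> sets \<nu>" "B' c \<subseteq> slab (length c)"
begin

abbreviation "H k \<omega> \<equiv> hist B B' (\<pi> \<omega>) (\<pi>' \<omega>) k"

lemma hist_measurable [measurable]: "H k \<in> measurable M (count_space UNIV)"
proof -
  have "H k -` {(c, c')} \<inter> space M \<in> sets M" for c c'
  proof -
    note [measurable] = p.num_points_measurable[OF B(1)] p'.num_points_measurable[OF B'(1)]
    have "H k -` {(c, c')} \<inter> space M = {\<omega>\<in>space M. length c = k \<and> length c' = k \<and>
       (\<forall>j<k. num_points (\<pi> \<omega>) (B (take j c')) = c ! j) \<and> (\<forall>j<k. num_points (\<pi>' \<omega>) (B' (take j c)) = c' ! j)}"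
      by (auto simp: hist_eq_iff)
    also have "\<dots> \<in> sets M" by measurable
    finally show ?thesis .
  qed
  then show ?thesis
    by (subst measurable_count_space_eq2_countable) auto
qed

text \<open>There are only countably many histories, and each of them is an event about counts in fixed
  disjoint sets, so no independence of sigma-algebras generated by the measures is needed.\<close>
lemma nn_integral_hist_region:
  assumes C: "\<And>c. C c \<in> sets \<nu>" "\<And>c. C c \<subseteq> slab (length c)" "\<And>c. emeasure \<nu> (C c) < \<infinity>"
  shows "(\<lambda>\<omega>. emeasure (\<pi> \<omega>) (C (snd (H k \<omega>)))) \<in> borel_measurable M" (is ?meas)
    and "(\<integral>\<^sup>+\<omega>. emeasure (\<pi> \<omega>) (C (snd (H k \<omega>))) \<partial>M) = (\<integral>\<^sup>+\<omega>. emeasure \<nu> (C (snd (H k \<omega>))) \<partial>M)"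
proof -
  note [measurable] = p.count_measurable[OF C(1)]
  \<comment> \<open>A sum over the countably many histories, written as an integral so that it can
    be exchanged with the expectation.\<close>
  have expand: "f (H k \<omega>) = (\<integral>\<^sup>+x. f x * indicator {x} (H k \<omega>) \<partial>count_space UNIV)" for f :: "_ \<Rightarrow> ennreal" and \<omega>
    using nn_integral_indicator_singleton[of "H k \<omega>" "count_space UNIV" f]
    by (simp add: indicator_def eq_commute)
  show ?meas
    by (rule measurable_compose_countable[where f="\<lambda>x \<omega>. emeasure (\<pi> \<omega>) (C (snd x))" and g="H k"]) measurable
  have *: "(\<integral>\<^sup>+\<omega>. emeasure (\<pi> \<omega>) (C (snd x)) * indicator {x} (H k \<omega>) \<partial>M)
      = (\<integral>\<^sup>+\<omega>. emeasure \<nu> (C (snd x)) * indicator {x} (H k \<omega>) \<partial>M)" for x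
  proof -
    obtain c c' where x: "x = (c, c')" by (cases x)
    show ?thesis
    proof (cases "length c = k \<and> length c' = k")
      case False
      then have "H k \<omega> \<noteq> x" for \<omega>
        using hist_eq_iff[of B B' "\<pi> \<omega>" "\<pi>' \<omega>" k c c'] x by auto
      then show ?thesis by (auto simp: indicator_def intro!: nn_integral_cong)
    next
      case True
      \<comment> \<open>The sets visited along the history \<open>x\<close>, followed by the test
        region in the current slab.\<close>
      define D where "D j = (if j < k then B (take j c') else C c')" for j
      define D' where "D' j = B' (take j c)" for j
      have D_slab: "D j \<subseteq> slab j" if "j \<le> k" for j
        using that B(2)[of "take j c'"] C(2)[of c'] True by (auto simp: D_def min_def)
      have ind: "indicator {x} (H k \<omega>) = (indicator {\<omega>. \<forall>j<k. num_points (\<pi> \<omega>) (D j) = c ! j} \<omega> *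
          indicator {\<omega>. \<forall>j<k. num_points (\<pi>' \<omega>) (D' j) = c' ! j} \<omega> :: ennreal)" for \<omega>
        using True hist_eq_iff[of B B' "\<pi> \<omega>" "\<pi>' \<omega>" k c c'] x by (auto simp: indicator_def D_def D'_def)
      have "(\<integral>\<^sup>+\<omega>. emeasure (\<pi> \<omega>) (D k) * indicator {x} (H k \<omega>) \<partial>M)
          = (\<integral>\<^sup>+\<omega>. indicator {x} (H k \<omega>) \<partial>M) * emeasure \<nu> (D k)"
        unfolding ind mult.commute[of "emeasure (\<pi> _) _"]
      proof (rule nn_integral_indep_two_counts[OF p.poisson_random_measure_axioms p'.poisson_random_measure_axioms indep])
        show "disjoint_family_on D {..k}"
          unfolding disjoint_family_on_def
        proof (intro ballI impI)
          fix i j assume "i \<in> {..k}" "j \<in> {..k}" "i \<noteq> j"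
          then show "D i \<inter> D j = {}"
            using disjoint_family_onD[OF disjoint_slab, of i j] D_slab[of i] D_slab[of j] by auto
        qed
      qed (use B B' C in \<open>auto simp: D_def D'_def\<close>)
      also have "\<dots> = (\<integral>\<^sup>+\<omega>. emeasure \<nu> (D k) * indicator {x} (H k \<omega>) \<partial>M)"
        by (subst nn_integral_cmult) (auto simp: mult.commute)
      finally show ?thesis by (simp add: D_def x)
    qed
  qed
  have "(\<integral>\<^sup>+\<omega>. emeasure (\<pi> \<omega>) (C (snd (H k \<omega>))) \<partial>M)
      = (\<integral>\<^sup>+\<omega>. (\<integral>\<^sup>+x. emeasure (\<pi> \<omega>) (C (snd x)) * indicator {x} (H k \<omega>) \<partial>count_space UNIV) \<partial>M)"
    by (subst expand[symmetric]) simp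
  also have "\<dots> = (\<integral>\<^sup>+x. (\<integral>\<^sup>+\<omega>. emeasure (\<pi> \<omega>) (C (snd x)) * indicator {x} (H k \<omega>) \<partial>M) \<partial>count_space UNIV)"
    by (subst nn_integral_count_space_nn_integral) auto
  also have "\<dots> = (\<integral>\<^sup>+x. (\<integral>\<^sup>+\<omega>. emeasure \<nu> (C (snd x)) * indicator {x} (H k \<omega>) \<partial>M) \<partial>count_space UNIV)"
    unfolding * ..
  also have "\<dots> = (\<integral>\<^sup>+\<omega>. (\<integral>\<^sup>+x. emeasure \<nu> (C (snd x)) * indicator {x} (H k \<omega>) \<partial>count_space UNIV) \<partial>M)"
    by (subst nn_integral_count_space_nn_integral) auto
  also have "\<dots> = (\<integral>\<^sup>+\<omega>. emeasure \<nu> (C (snd (H k \<omega>))) \<partial>M)"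
    by (subst expand[symmetric]) simp
  finally show "(\<integral>\<^sup>+\<omega>. emeasure (\<pi> \<omega>) (C (snd (H k \<omega>))) \<partial>M) = (\<integral>\<^sup>+\<omega>. emeasure \<nu> (C (snd (H k \<omega>))) \<partial>M)" .
qed

end

section \<open>The discretised mean equation\<close>

text \<open>With z = beta h and q = exp (- z): the input z q^2 per step is at most the loss 1 - q,
  which keeps the recursion for \<open>y\<close> below its level \<open>\<Delta>\<close>.\<close>

lemma exp_minus_square_le:
  fixes z :: real assumes "0 \<le> z" shows "z * exp (- z) * exp (- z) \<le> 1 - exp (- z)"
proof -
  have "z * exp (- z) \<le> z" using assms by (simp add: mult_left_le)
  also have "z \<le> exp z - 1" using exp_ge_add_one_self[of z] by linarith
  finally have "z * exp (- z) * exp (- z) \<le> (exp z - 1) * exp (- z)"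
    by (rule mult_right_mono) simp
  also have "\<dots> = 1 - exp (- z)" by (simp add: algebra_simps flip: exp_add)
  finally show ?thesis .
qed

lemma exp_minus_taylor:
  fixes z :: real assumes "0 \<le> z" shows "\<bar>exp (- z) - 1 + z\<bar> \<le> z\<^sup>2"
proof -
  have 1: "1 - z \<le> exp (- z)" using exp_ge_add_one_self[of "- z"] by simp
  have "exp (- z) * (1 + z) \<le> exp (- z) * exp z"
    using exp_ge_add_one_self[of z] by (intro mult_left_mono) auto
  then have "exp (- z) * (1 + z) \<le> 1" by (simp flip: exp_add)
  then have "exp (- z) - 1 \<le> - z * exp (- z)" by (simp add: algebra_simps)
  moreover have "z * (1 - z) \<le> z * exp (- z)" using 1 assms by (intro mult_left_mono)
  ultimately show ?thesis using 1 by (simp add: power2_eq_square algebra_simps abs_le_iff)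
qed

text \<open>\<open>y\<close> is the difference of the two mean excitations; the minus sign before
  \<open>a k * y k\<close> arises because an excess of one process feeds the other. The outer
  \<open>q\<close> ages everything by one step, the inner one is the extra rounding applied to a
  fresh count.\<close>

locale discrete_difference =
  fixes h \<beta> \<Delta> :: real and a y :: "nat \<Rightarrow> real" and q :: real
  defines "q \<equiv> exp (- (\<beta> * h))"
  assumes h: "0 < h" and \<beta>: "0 < \<beta>" and \<Delta>: "0 \<le> \<Delta>"
    and a: "0 \<le> a k" "a k \<le> 1"
    and y0: "y 0 = 0"
    and ySuc: "y (Suc k) = q * (y k + \<beta> * (q * (h * (\<Delta> - a k * y k))))"
begin

lemma q: "0 < q" "q \<le> 1" "\<beta> * h * q \<le> 1" "\<beta> * h * q * q \<le> 1 - q"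
proof -
  show "0 < q" "q \<le> 1" using h \<beta> by (auto simp: q_def)
  show "\<beta> * h * q * q \<le> 1 - q" using exp_minus_square_le[of "\<beta> * h"] h \<beta> by (simp add: q_def)
  have "\<beta> * h * q \<le> exp (\<beta> * h) * q"
    using exp_ge_add_one_self[of "\<beta> * h"] by (intro mult_right_mono) (linarith, simp add: q_def)
  then show "\<beta> * h * q \<le> 1" by (simp add: q_def flip: exp_add)
qed

text \<open>Each step combines \<open>y k\<close> and \<open>\<Delta>\<close> with nonnegative
  coefficients of total at most 1. The bound is free of the horizon, and so the final error is
  bounded in T.\<close>

lemma y_bounds: "0 \<le> y k" "y k \<le> \<Delta>"
proof (induction k)
  case (Suc k)
  have eq: "y (Suc k) = q * ((1 - (\<beta> * h * q) * a k) * y k) + (\<beta> * h * q * q) * \<Delta>"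
    by (simp add: ySuc algebra_simps)
  have *: "(\<beta> * h * q) * a k \<le> 1 * 1" "0 \<le> (\<beta> * h * q) * a k"
    using q a[of k] h \<beta> by (intro mult_mono mult_nonneg_nonneg, simp_all)+
  {
    case 1
    show ?case unfolding eq using * Suc q h \<beta> \<Delta> by (auto intro!: add_nonneg_nonneg mult_nonneg_nonneg)
  next
    case 2
    have "(1 - (\<beta> * h * q) * a k) * y k \<le> 1 * \<Delta>" using * Suc by (intro mult_mono) auto
    then have "q * ((1 - (\<beta> * h * q) * a k) * y k) \<le> q * \<Delta>" using q by (intro mult_left_mono) auto
    moreover have "(\<beta> * h * q * q) * \<Delta> \<le> (1 - q) * \<Delta>" using q \<Delta> by (intro mult_right_mono) auto
    ultimately show ?case unfolding eq by (simp add: algebra_simps)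
  }
qed (simp_all add: y0 \<Delta>)

text \<open>One unit of the constant 3 is the quadratic error of \<open>exp (- z)\<close>; two come
  from replacing \<open>q * q\<close> by 1, since the difference is (1 - q) (1 + q).\<close>

lemma y_step: "\<bar>y (Suc k) - y k - \<beta> * h * (\<Delta> - (1 + a k) * y k)\<bar> \<le> 3 * (\<beta> * h)\<^sup>2 * \<Delta>"
proof -
  have z: "0 \<le> \<beta> * h" using h \<beta> by simp
  have "y (Suc k) - y k - \<beta> * h * (\<Delta> - (1 + a k) * y k)
      = (q - 1 + \<beta> * h) * y k + \<beta> * h * ((q - 1) * (q + 1)) * (\<Delta> - a k * y k)"
    by (simp add: ySuc algebra_simps)
  also have "\<bar>\<dots>\<bar> \<le> \<bar>q - 1 + \<beta> * h\<bar> * \<bar>y k\<bar> + \<bar>\<beta> * h * ((q - 1) * (q + 1))\<bar> * \<bar>\<Delta> - a k * y k\<bar>"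
    by (metis abs_mult abs_triangle_ineq)
  also have "\<dots> \<le> (\<beta> * h)\<^sup>2 * \<Delta> + (2 * (\<beta> * h)\<^sup>2) * \<Delta>"
  proof (intro add_mono mult_mono)
    show "\<bar>q - 1 + \<beta> * h\<bar> \<le> (\<beta> * h)\<^sup>2" using exp_minus_taylor[OF z] by (simp add: q_def)
    have "1 - q \<le> \<beta> * h" using exp_ge_add_one_self[of "- (\<beta> * h)"] by (simp add: q_def)
    then have "\<beta> * h * ((1 - q) * (1 + q)) \<le> \<beta> * h * ((\<beta> * h) * 2)"
      using z q by (intro mult_left_mono mult_mono) auto
    moreover have "\<bar>\<beta> * h * ((q - 1) * (q + 1))\<bar> = \<beta> * h * ((1 - q) * (1 + q))"
      using h \<beta> q by (simp add: abs_mult)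
    ultimately show "\<bar>\<beta> * h * ((q - 1) * (q + 1))\<bar> \<le> 2 * (\<beta> * h)\<^sup>2"
      by (simp add: power2_eq_square mult_ac)
    have "a k * y k \<le> 1 * \<Delta>" "0 \<le> a k * y k"
      using a[of k] y_bounds[of k] by (intro mult_mono mult_nonneg_nonneg, simp_all)+
    then show "\<bar>\<Delta> - a k * y k\<bar> \<le> \<Delta>" by auto
  qed (use y_bounds in auto)
  finally show ?thesis by (simp add: mult_ac)
qed

text \<open>The corrected sum \<open>D\<^sub>k - g y\<^sub>k / \<beta>\<close> has increments \<open>\<Delta> h / (1 + \<alpha>)\<close> up to second order, because
  \<open>g (1 + \<alpha>) = \<alpha>\<close>.\<close>
lemma sum_difference_approx:
  fixes g F :: "real \<Rightarrow> real" and \<alpha> :: "real \<Rightarrow> real"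
  assumes T: "0 < T" "real n * h \<le> T"
    and ak: "\<And>k. k < n \<Longrightarrow> a k = \<alpha> (real (Suc k) * h / T)"
    and \<alpha>: "\<And>x. x \<in> {0..1} \<Longrightarrow> 0 \<le> \<alpha> x"
    and g: "\<And>x. g x = \<alpha> x / (1 + \<alpha> x)"
    and lip: "\<And>x x'. 0 \<le> x \<Longrightarrow> x \<le> x' \<Longrightarrow> x' \<le> 1 \<Longrightarrow> \<bar>g x - g x'\<bar> \<le> 2 * (x' - x)"
    and F: "F 0 = 0" "\<And>x. x \<in> {0..1} \<Longrightarrow> (F has_real_derivative 1 / (1 + \<alpha> x)) (at x)"
  shows "\<bar>(\<Sum>k<n. h * (\<Delta> - a k * y k)) - T * \<Delta> * F (real n * h / T)\<bar>
     \<le> 3 * \<Delta> / \<beta> + (3 * \<beta> * T + 2) * \<Delta> * h"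
proof -
  define x where "x k = real k * h / T" for k
  define G where "G k = (\<Sum>j<k. h * (\<Delta> - a j * y j)) - g (x k) * y k / \<beta> - T * \<Delta> * F (x k)" for k
  \<comment> \<open>Error per step: the local error of the recursion divided by
    \<open>\<beta>\<close>, the variation of \<open>g\<close> between grid points, and the distance
    from the mean value point to the right endpoint. Summed over at most T / h steps, the second
    gives 2 Delta / beta; the boundary term \<open>g (x n) * y n / \<beta>\<close> raises this to 3
    Delta / beta, and the other two are of order h.\<close>
  define c where "c = 3 * \<beta> * h\<^sup>2 * \<Delta> + 2 * (h / T) * \<Delta> / \<beta> + 2 * \<Delta> * h\<^sup>2 / T"
  have tri: "\<bar>s - s' + s''\<bar> \<le> \<bar>s\<bar> + \<bar>s'\<bar> + \<bar>s''\<bar>" for s s' s'' :: real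
    by linarith
  have g01: "0 \<le> g t" "g t \<le> 1" "1 - g t = 1 / (1 + \<alpha> t)" "g t * (1 + \<alpha> t) = \<alpha> t" if "t \<in> {0..1}" for t
    using \<alpha>[OF that] by (auto simp: g field_simps)
  have x01: "x k \<in> {0..1}" if "k \<le> n" for k
  proof -
    have "real k * h \<le> real n * h" using that h by simp
    then have "0 \<le> real k * h" "real k * h \<le> T" using T h by (simp, linarith)
    then show ?thesis using T by (simp add: x_def)
  qed
  have step: "\<bar>G (Suc k) - G k\<bar> \<le> c" if k: "k < n" for k
  proof -
    have xS: "x (Suc k) = x k + h / T" by (simp add: x_def distrib_right add_divide_distrib)
    have xk: "x k \<in> {0..1}" "x (Suc k) \<in> {0..1}" using x01[of k] x01[of "Suc k"] k by auto
    have lt: "x k < x (Suc k)" using xS h T by simp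
    obtain t where t: "x k < t" "t < x (Suc k)" "F (x (Suc k)) - F (x k) = (x (Suc k) - x k) * (1 / (1 + \<alpha> t))"
      using MVT2[OF lt, of F "\<lambda>t. 1 / (1 + \<alpha> t)"] F(2) xk by auto
    have t01: "t \<in> {0..1}" using t xk by auto
    have Fdiff: "T * \<Delta> * F (x (Suc k)) - T * \<Delta> * F (x k) = h * \<Delta> * (1 - g t)"
    proof -
      have "T * \<Delta> * F (x (Suc k)) - T * \<Delta> * F (x k) = T * \<Delta> * (F (x (Suc k)) - F (x k))"
        by (simp add: algebra_simps)
      also have "\<dots> = T * \<Delta> * (h / T * (1 - g t))" unfolding t(3) using xS g01(3)[OF t01] by simp
      finally show ?thesis using T by simp
    qed
    define e where "e = y (Suc k) - y k - \<beta> * h * (\<Delta> - (1 + a k) * y k)"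
    have e: "\<bar>e\<bar> \<le> 3 * (\<beta> * h)\<^sup>2 * \<Delta>" unfolding e_def by (rule y_step)
    \<comment> \<open>\<open>g\<close> is taken at the right endpoint because \<open>a k\<close>
      samples \<open>\<alpha>\<close> there; then r (1 + a k) = a k, and the terms in
      \<open>a k * y k\<close> cancel.\<close>
    define r where "r = g (x (Suc k))"
    have r: "0 \<le> r" "r \<le> 1" "r * (1 + a k) = a k"
      using g01[OF xk(2)] ak[OF k] by (auto simp: r_def x_def)
    have yS: "y (Suc k) = y k + \<beta> * h * (\<Delta> - (1 + a k) * y k) + e" by (simp add: e_def)
    have "r * (\<beta> * h * (\<Delta> - (1 + a k) * y k)) = \<beta> * h * (r * \<Delta> - (r * (1 + a k)) * y k)"
      by (simp add: algebra_simps)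
    also have "\<dots> = \<beta> * h * (r * \<Delta> - a k * y k)" unfolding r(3) ..
    finally have "r * y (Suc k) / \<beta> = r * y k / \<beta> + h * (r * \<Delta> - a k * y k) + r * e / \<beta>"
      using \<beta> by (simp add: yS distrib_left add_divide_distrib)
    then have "G (Suc k) - G k = h * (\<Delta> - a k * y k)
        - (r * y k / \<beta> + h * (r * \<Delta> - a k * y k) + r * e / \<beta>) + g (x k) * y k / \<beta> - h * \<Delta> * (1 - g t)"
      unfolding Fdiff[symmetric] by (simp add: G_def r_def)
    also have "\<dots> = h * \<Delta> * (g t - r) - r * e / \<beta> + (g (x k) - r) * y k / \<beta>"
      by (simp add: algebra_simps diff_divide_distrib)
    also have "\<bar>\<dots>\<bar> \<le> \<bar>h * \<Delta> * (g t - r)\<bar> + \<bar>r * e / \<beta>\<bar> + \<bar>(g (x k) - r) * y k / \<beta>\<bar>"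
      by (rule tri)
    also have "\<dots> \<le> h * \<Delta> * (2 * (h / T)) + 1 * (3 * (\<beta> * h)\<^sup>2 * \<Delta>) / \<beta> + (2 * (h / T)) * \<Delta> / \<beta>"
    proof (intro add_mono)
      have "\<bar>g t - r\<bar> \<le> 2 * (x (Suc k) - t)" unfolding r_def by (rule lip) (use t t01 xk in auto)
      also have "\<dots> \<le> 2 * (h / T)" using t xS by simp
      finally show "\<bar>h * \<Delta> * (g t - r)\<bar> \<le> h * \<Delta> * (2 * (h / T))"
        unfolding abs_mult using h \<Delta> by (intro mult_mono) auto
      show "\<bar>r * e / \<beta>\<bar> \<le> 1 * (3 * (\<beta> * h)\<^sup>2 * \<Delta>) / \<beta>"
        unfolding abs_mult abs_divide using r e \<beta> \<Delta> by (intro divide_mono mult_mono) auto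
      have "\<bar>g (x k) - r\<bar> \<le> 2 * (x (Suc k) - x k)" unfolding r_def by (rule lip) (use lt xk in auto)
      then show "\<bar>(g (x k) - r) * y k / \<beta>\<bar> \<le> (2 * (h / T)) * \<Delta> / \<beta>"
        unfolding abs_mult abs_divide using xS h T y_bounds[of k] \<beta>
        by (intro divide_mono mult_mono) auto
    qed
    also have "\<dots> = c" using \<beta> by (simp add: c_def power2_eq_square field_simps)
    finally show ?thesis .
  qed
  have "\<bar>G k - G 0\<bar> \<le> real k * c" if "k \<le> n" for k
    using that
  proof (induction k)
    case (Suc k)
    then show ?case using step[of k] by (simp add: algebra_simps)
  qed simp
  then have "\<bar>G n - G 0\<bar> \<le> real n * c" by simp
  moreover have "G 0 = 0" by (simp add: G_def x_def y0 F(1))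
  moreover have "real n * c \<le> (3 * \<beta> * T + 2) * \<Delta> * h + 2 * \<Delta> / \<beta>"
  proof -
    have "real n * c = (real n * h) * (3 * \<beta> * h * \<Delta> + 2 * \<Delta> / (T * \<beta>) + 2 * \<Delta> * h / T)"
      by (simp add: c_def power2_eq_square field_simps)
    also have "\<dots> \<le> T * (3 * \<beta> * h * \<Delta> + 2 * \<Delta> / (T * \<beta>) + 2 * \<Delta> * h / T)"
      using T h \<beta> \<Delta> by (intro mult_right_mono) auto
    also have "\<dots> = (3 * \<beta> * T + 2) * \<Delta> * h + 2 * \<Delta> / \<beta>" using T \<beta> by (simp add: field_simps)
    finally show ?thesis .
  qed
  moreover have "\<bar>g (x n) * y n / \<beta>\<bar> \<le> 1 * \<Delta> / \<beta>"
    unfolding abs_mult abs_divide using g01[OF x01[OF order_refl]] y_bounds[of n] \<beta>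
    by (intro divide_mono mult_mono) auto
  moreover have "(\<Sum>k<n. h * (\<Delta> - a k * y k)) - T * \<Delta> * F (real n * h / T) = G n + g (x n) * y n / \<beta>"
    by (simp add: G_def x_def)
  moreover have "3 * \<Delta> / \<beta> = 2 * \<Delta> / \<beta> + 1 * \<Delta> / \<beta>"
    by (simp flip: add_divide_distrib)
  ultimately show ?thesis by linarith
qed

end

text \<open>As \<open>a k \<le> 1\<close>, excitation does not outweigh decay, so \<open>z\<close>
  grows at most linearly. The bound is crude but uniform in the mesh for a given
  \<open>real n * h\<close>, which is enough to make the limiting count integrable.\<close>

lemma discrete_sum_bound:
  fixes h \<beta> m :: real and a z :: "nat \<Rightarrow> real" and q :: real
  defines "q \<equiv> exp (- (\<beta> * h))"
  assumes h: "0 < h" and \<beta>: "0 < \<beta>" and m: "0 \<le> m" and a: "\<And>k. 0 \<le> a k" "\<And>k. a k \<le> 1"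
    and z0: "z 0 = 0" and zSuc: "\<And>k. z (Suc k) = q * (z k + \<beta> * (q * (h * (m + a k * z k))))"
  shows "(\<Sum>k<n. h * (m + a k * z k)) \<le> (real n * h) * (m + \<beta> * m * (real n * h))"
proof -
  have q: "0 < q" "q \<le> 1" "q * (1 + \<beta> * h) \<le> 1"
  proof -
    show "0 < q" "q \<le> 1" using h \<beta> by (auto simp: q_def)
    have "q * (1 + \<beta> * h) \<le> q * exp (\<beta> * h)"
      using exp_ge_add_one_self[of "\<beta> * h"] by (intro mult_left_mono) (auto simp: q_def)
    then show "q * (1 + \<beta> * h) \<le> 1" by (simp add: q_def flip: exp_add)
  qed
  have z: "0 \<le> z k \<and> z k \<le> \<beta> * m * (real k * h)" for k
  proof (induction k)
    case (Suc k)
    have eq: "z (Suc k) = q * (1 + \<beta> * h * (q * a k)) * z k + \<beta> * h * m * (q * q)"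
      by (simp add: zSuc algebra_simps)
    have qa: "0 \<le> q * a k" "q * a k \<le> 1 * 1" using q a[of k] by (auto intro: mult_le_one)
    have "0 \<le> z (Suc k)"
      unfolding eq using qa q Suc h \<beta> m by (auto intro!: add_nonneg_nonneg mult_nonneg_nonneg)
    moreover have "z (Suc k) \<le> 1 * z k + \<beta> * h * m * (1 * 1)"
      unfolding eq
    proof (intro add_mono mult_mono)
      have "\<beta> * h * (q * a k) \<le> \<beta> * h * 1" using qa h \<beta> by (intro mult_left_mono) auto
      then have "q * (1 + \<beta> * h * (q * a k)) \<le> q * (1 + \<beta> * h)" using q by (intro mult_left_mono) auto
      then show "q * (1 + \<beta> * h * (q * a k)) \<le> 1" using q by linarith
    qed (use q Suc h \<beta> m in auto)
    ultimately show ?case using Suc by (simp add: algebra_simps)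
  qed (simp add: z0)
  have "(\<Sum>k<n. h * (m + a k * z k)) \<le> (\<Sum>k<n. h * (m + 1 * (\<beta> * m * (real n * h))))"
  proof (intro sum_mono mult_left_mono add_left_mono mult_mono)
    fix k assume "k \<in> {..<n}"
    then have "\<beta> * m * (real k * h) \<le> \<beta> * m * (real n * h)"
      using \<beta> m h by (intro mult_left_mono mult_right_mono) auto
    then show "z k \<le> \<beta> * m * (real n * h)" using z[of k] by linarith
  qed (use a z h in auto)
  then show ?thesis by (simp add: algebra_simps)
qed

section \<open>Paths defined by thinning\<close>

text \<open>With the weight exp (beta s) the integrand depends on t only through the domain, so the
  integral is monotone in t and its superlevel sets are intervals. The factor exp (- beta t) later
  restores the kernel.\<close>

lemma set_lebesgue_integral_exp_measurable:
  fixes \<nu> :: "real measure"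
  assumes [measurable_cong]: "sets \<nu> = sets borel"
  shows "(\<lambda>t. LINT s:{0..<t}|\<nu>. exp (\<beta> * s)) \<in> borel_measurable borel"
proof -
  define E where "E t = (\<integral>\<^sup>+s. ennreal (indicator {0..<t} s * exp (\<beta> * s)) \<partial>\<nu>)" for t
  have mono: "E t \<le> E t'" if "t \<le> t'" for t t'
    unfolding E_def using that by (intro nn_integral_mono ennreal_leI) (auto simp: indicator_def)
  have "E \<in> borel_measurable borel"
  proof (rule borel_measurableI_greater)
    fix z
    have "is_interval {t. z < E t}"
      unfolding is_interval_1 using mono by (blast intro: less_le_trans)
    then show "{t \<in> space borel. z < E t} \<in> sets borel"
      by (simp add: real_interval_borel_measurable)
  qed
  then have "(\<lambda>t. enn2real (E t)) \<in> borel_measurable borel" by measurable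
  also have "(\<lambda>t. enn2real (E t)) = (\<lambda>t. LINT s:{0..<t}|\<nu>. exp (\<beta> * s))"
    unfolding set_lebesgue_integral_def E_def
    by (subst integral_eq_nn_integral) (auto simp: indicator_def)
  finally show ?thesis .
qed

lemma intensity_eq:
  "intensity \<mu> \<alpha> \<beta> T N t = \<mu> + \<alpha> (t / T) * \<beta> * (LINT s:{0..<t}|path_measure T N. exp (- \<beta> * (t - s)))"
proof -
  have "(LINT s:{0..<t}|path_measure T N. \<alpha> (t / T) * (\<beta> * exp (- \<beta> * (t - s))))
      = (LINT s:{0..<t}|path_measure T N. (\<alpha> (t / T) * \<beta>) * exp (- \<beta> * (t - s)))"
    by (simp add: mult.assoc)
  then show ?thesis by (simp add: intensity_def)
qed

lemma intensity_measurable: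
  assumes [measurable]: "\<alpha> \<in> borel_measurable borel"
  shows "intensity \<mu> \<alpha> \<beta> T N \<in> borel_measurable borel"
proof -
  have [measurable]: "(\<lambda>t. LINT s:{0..<t}|path_measure T N. exp (\<beta> * s)) \<in> borel_measurable borel"
    by (rule set_lebesgue_integral_exp_measurable) (simp add: path_measure_def)
  have "(\<lambda>s. exp (- \<beta> * (t - s))) = (\<lambda>s. exp (- \<beta> * t) * exp (\<beta> * s))" for t
    by (auto simp: algebra_simps simp flip: exp_add)
  then have "intensity \<mu> \<alpha> \<beta> T N
      = (\<lambda>t. \<mu> + \<alpha> (t / T) * \<beta> * (exp (- \<beta> * t) * (LINT s:{0..<t}|path_measure T N. exp (\<beta> * s))))"
    by (auto simp: intensity_eq)
  also have "\<dots> \<in> borel_measurable borel" by measurable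
  finally show ?thesis .
qed

locale thinned_path =
  fixes p :: "(real \<times> real) measure" and l :: "real \<Rightarrow> real" and T :: real and N :: "real \<Rightarrow> nat"
  assumes sets_p [measurable_cong, simp]: "sets p = sets borel"
    and l [measurable]: "l \<in> borel_measurable borel"
    and T: "0 < T"
    and thinning: "t \<in> {0..T} \<Longrightarrow> of_nat (N t) = emeasure p (thinning_region l t)"
begin

lemma region_sets [measurable]: "thinning_region l t \<in> sets p"
proof -
  have "thinning_region l t = {z \<in> space (borel \<Otimes>\<^sub>M borel). 0 \<le> fst z \<and> fst z \<le> l (snd z) \<and> 0 < snd z \<and> snd z \<le> t}"
    by (auto simp: thinning_region_def space_pair_measure)
  also have "\<dots> \<in> sets (borel \<Otimes>\<^sub>M borel)"
    by measurable
  finally show ?thesis unfolding sets_p borel_prod[symmetric] .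
qed

lemma emeasure_increment:
  assumes "0 \<le> s" "s \<le> t" "t \<le> T"
  shows "emeasure p (thinning_region l t - thinning_region l s) = of_nat (N t - N s)" "N s \<le> N t"
proof -
  have sub: "thinning_region l s \<subseteq> thinning_region l t"
    using assms by (auto simp: thinning_region_def)
  have eq: "of_nat (N s) = emeasure p (thinning_region l s)" "of_nat (N t) = emeasure p (thinning_region l t)"
    using assms by (auto intro!: thinning)
  have "of_nat (N s) \<le> (of_nat (N t) :: ennreal)"
    unfolding eq by (intro emeasure_mono sub region_sets)
  then show "N s \<le> N t" by simp
  have "emeasure p (thinning_region l t - thinning_region l s)
      = emeasure p (thinning_region l t) - emeasure p (thinning_region l s)"
    using assms by (intro emeasure_Diff sub region_sets) (simp flip: thinning)
  also have "\<dots> = ennreal (real (N t)) - ennreal (real (N s))"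
    unfolding eq[symmetric] ennreal_of_nat_eq_real_of_nat ..
  also have "\<dots> = of_nat (N t - N s)"
    using \<open>N s \<le> N t\<close> by (subst ennreal_minus) (simp_all add: of_nat_diff ennreal_of_nat_eq_real_of_nat)
  finally show "emeasure p (thinning_region l t - thinning_region l s) = of_nat (N t - N s)" .
qed

text \<open>A monotone nat-valued function bounded on [0, s) attains its maximum there and keeps
  that value up to s.\<close>

lemma N_left_constant:
  assumes "0 < s" "s \<le> T"
  obtains s' where "0 \<le> s'" "s' < s" "\<And>r. s' \<le> r \<Longrightarrow> r < s \<Longrightarrow> N r = N s'"
proof -
  have "finite (N ` {0..<s})"
    by (rule finite_subset[of _ "{..N s}"]) (use emeasure_increment(2) assms in auto)
  moreover have "N ` {0..<s} \<noteq> {}" using assms by auto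
  ultimately obtain s' where s': "s' \<in> {0..<s}" "N s' = Max (N ` {0..<s})"
    by (metis (no_types, lifting) Max_in image_iff)
  have "N r = N s'" if "s' \<le> r" "r < s" for r
  proof (rule antisym)
    show "N r \<le> N s'" unfolding s'(2) using that s'(1) \<open>finite (N ` {0..<s})\<close> by (intro Max_ge) auto
    show "N s' \<le> N r" using that s'(1) assms by (intro emeasure_increment) auto
  qed
  then show ?thesis using that s'(1) by auto
qed

text \<open>Continuity from above: the parts of the region over (t, t + d] decrease to the empty set
  and carry finite integer mass, so the mass is 0 for some d.\<close>

lemma N_right_constant:
  assumes "0 \<le> t" "t < T"
  obtains \<delta> where "0 < \<delta>" "t + \<delta> \<le> T" "\<And>r. t \<le> r \<Longrightarrow> r \<le> t + \<delta> \<Longrightarrow> N r = N t"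
proof -
  define d where "d n = (T - t) / real (Suc n)" for n
  have d: "0 < d n" "t + d n \<le> T" for n
    using assms divide_left_mono[of 1 "real (Suc n)" "T - t"] by (auto simp: d_def)
  define A where "A n = thinning_region l (t + d n) - thinning_region l t" for n
  have "decseq d" unfolding d_def using assms by (intro decseq_SucI divide_left_mono) auto
  then have "decseq A" unfolding decseq_def A_def thinning_region_def by fastforce
  have emA: "emeasure p (A n) = of_nat (N (t + d n) - N t)" for n
    unfolding A_def using d[of n] assms by (intro emeasure_increment) auto
  have "(\<lambda>n. emeasure p (A n)) \<longlonglongrightarrow> emeasure p (\<Inter>n. A n)"
  proof (rule Lim_emeasure_decseq[OF _ \<open>decseq A\<close>])
    show "range A \<subseteq> sets p" unfolding A_def by (intro image_subsetI sets.Diff region_sets)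
  qed (simp add: emA)
  moreover have "(\<Inter>n. A n) = {}"
  proof -
    have "d \<longlonglongrightarrow> 0" unfolding d_def by real_asymp
    have False if "(x, s) \<in> (\<Inter>n. A n)" for x s
    proof -
      have "\<And>n. s \<le> t + d n \<and> t < s" using that assms by (auto simp: A_def thinning_region_def)
      then have "t < s" "\<And>n. s - t \<le> d n" by (auto simp: algebra_simps)
      then show False using LIMSEQ_le_const[OF \<open>d \<longlonglongrightarrow> 0\<close>, of "s - t"] by auto
    qed
    then show ?thesis by auto
  qed
  ultimately have "(\<lambda>n. emeasure p (A n)) \<longlonglongrightarrow> 0" by simp
  then have "eventually (\<lambda>n. emeasure p (A n) < 1) sequentially"
    by (rule order_tendstoD) simp
  then obtain n where "emeasure p (A n) < 1" by (auto simp: eventually_sequentially)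
  then have "N (t + d n) - N t < 1"
    unfolding emA by (metis of_nat_1 of_nat_less_iff)
  then have "N (t + d n) \<le> N t" by simp
  then have "N r = N t" if "t \<le> r" "r \<le> t + d n" for r
    using that emeasure_increment(2)[of t r] emeasure_increment(2)[of r "t + d n"] d[of n] assms by simp
  then show ?thesis using that d by blast
qed

section \<open>The Lebesgue-Stieltjes measure of a thinned path\<close>

abbreviation "dN \<equiv> path_measure T N"

lemma sets_dN [measurable_cong, simp]: "sets dN = sets borel"
  by (simp add: path_measure_def)

lemma emeasure_dN:
  assumes "a \<le> b"
  shows "emeasure dN {a<..b} = ennreal (real (N (max 0 (min T b))) - real (N (max 0 (min T a))))"
  unfolding path_measure_def
proof (rule emeasure_interval_measure_Ioc[OF assms])
  show "real (N (max 0 (min T x))) \<le> real (N (max 0 (min T y)))" if "x \<le> y" for x y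
    using that T by (intro of_nat_mono emeasure_increment) auto
  show "continuous (at_right a) (\<lambda>s. real (N (max 0 (min T s))))" for a
  proof -
    have "eventually (\<lambda>s. N (max 0 (min T s)) = N (max 0 (min T a))) (at_right a)"
    proof (cases "a < T")
      case True
      then obtain \<delta> where \<delta>: "0 < \<delta>" "\<And>r. max 0 a \<le> r \<Longrightarrow> r \<le> max 0 a + \<delta> \<Longrightarrow> N r = N (max 0 a)"
        using N_right_constant[of "max 0 a"] T by (metis max.cobounded1 max_less_iff_conj)
      have "N (max 0 (min T s)) = N (max 0 (min T a))" if "a < s" "s < min (a + \<delta>) T" for s
      proof -
        have "N (max 0 s) = N (max 0 a)" using that \<delta>(1) by (intro \<delta>(2)) auto
        then show ?thesis using that True by (simp add: min_absorb2)
      qed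
      then show ?thesis
        unfolding eventually_at_right_field using True \<delta>(1) by (intro exI[of _ "min (a + \<delta>) T"]) auto
    next
      case False
      then show ?thesis
        unfolding eventually_at_right_field by (intro exI[of _ "a + 1"]) (auto simp: min_absorb1)
    qed
    then have "((\<lambda>s. real (N (max 0 (min T s)))) \<longlongrightarrow> real (N (max 0 (min T a)))) (at_right a)"
      by (intro tendsto_eventually) (auto elim: eventually_mono)
    then show ?thesis by (simp add: continuous_within)
  qed
qed

lemma emeasure_dN':
  assumes "0 \<le> a" "a \<le> b" "b \<le> T"
  shows "emeasure dN {a<..b} = of_nat (N b - N a)"
  using assms emeasure_increment(2)[of a b]
  by (subst emeasure_dN) (auto simp: ennreal_of_nat_eq_real_of_nat of_nat_diff min_absorb2)

text \<open>There is no atom at 0 since the extended path is constant to the left of 0. The path may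
  jump at s itself, so the open interval is exhausted by \<open>{r<..q}\<close> with rational q <
  s.\<close>

lemma dN_null:
  assumes "s \<le> T" "0 \<le> r" "\<And>t. r \<le> t \<Longrightarrow> t < s \<Longrightarrow> N t = N r"
  shows "AE t in dN. t \<noteq> 0 \<and> \<not> (r < t \<and> t < s)"
proof -
  have "emeasure dN {0} \<le> emeasure dN {-1<..0}" by (intro emeasure_mono) auto
  also have "\<dots> = 0" using T by (simp add: emeasure_dN)
  finally have 1: "AE t in dN. t \<noteq> 0"
    by (intro AE_I[of _ _ "{0}"]) auto
  have "AE t in dN. \<not> (r < t \<and> t \<le> q)" if "q \<in> \<rat> \<and> r \<le> q \<and> q < s" for q
  proof -
    have "emeasure dN {r<..q} = 0" using assms(1,2) assms(3)[of q] that by (subst emeasure_dN') simp_all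
    then show ?thesis by (intro AE_I[of _ _ "{r<..q}"]) auto
  qed
  then have "AE t in dN. \<forall>q\<in>{q \<in> \<rat>. r \<le> q \<and> q < s}. \<not> (r < t \<and> t \<le> q)"
    by (subst AE_ball_countable) (auto intro: countable_subset[OF _ countable_rat])
  with 1 show ?thesis
  proof eventually_elim
    case (elim t)
    { assume t: "r < t" "t < s"
      then obtain q where q: "q \<in> \<rat>" "t < q" "q < s" using Rats_dense_in_real by blast
      then have "q \<in> {q \<in> \<rat>. r \<le> q \<and> q < s}" using t by simp
      with elim(2) have "\<not> (r < t \<and> t \<le> q)" by (rule bspec)
      then have False using q t by simp }
    then show ?case using elim(1) by blast
  qed
qed

end

section \<open>The lower scheme\<close>

text \<open>Ceiling minus one instead of floor: slabs are open on the left, so the grid point (j +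
  1) h belongs to slab j.\<close>

definition slab_index :: "real \<Rightarrow> real \<Rightarrow> nat" where
  "slab_index h s = nat (\<lceil>s / h\<rceil> - 1)"

lemma slab_index_iff:
  assumes "0 < h"
  shows "real j * h < s \<and> s \<le> real (Suc j) * h \<longleftrightarrow> 0 < s \<and> slab_index h s = j"
proof
  assume s: "real j * h < s \<and> s \<le> real (Suc j) * h"
  then have "real j < s / h" "s / h \<le> real j + 1" using assms by (auto simp: field_simps)
  then have "\<lceil>s / h\<rceil> = int j + 1" by (intro ceiling_unique) auto
  moreover have "0 \<le> real j * h" using assms by simp
  ultimately show "0 < s \<and> slab_index h s = j" using s by (auto simp: slab_index_def)
next
  assume s: "0 < s \<and> slab_index h s = j"
  then have "0 < s / h" using assms by simp
  then have "real j = of_int \<lceil>s / h\<rceil> - 1" using s by (auto simp: slab_index_def)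
  then have "real j < s / h" "s / h \<le> real j + 1" by linarith+
  then show "real j * h < s \<and> s \<le> real (Suc j) * h" using assms by (auto simp: field_simps)
qed

context thinned_path
begin

text \<open>\<open>V\<close> is the integral of a step function against the same \<open>dN\<close>,
  so both bounds compare kernels pointwise. Rounding elapsed times up lowers the kernel, and by at
  most 2 h in time: one h for dating a jump to the start of its slab, one for reading at the end of
  the current slab.\<close>

lemma weighted_increments_bounds:
  fixes \<beta> h s :: real and k :: nat
  defines "V \<equiv> \<Sum>j<k. real (N (real (Suc j) * h) - N (real j * h)) * exp (- (\<beta> * h * real (Suc k - j)))"
    and "J \<equiv> LINT r:{0..<s}|dN. exp (- \<beta> * (s - r))"
  assumes h: "0 < h" and \<beta>: "0 < \<beta>" and s: "real k * h < s" "s \<le> real (Suc k) * h" "s \<le> T"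
  shows "V \<le> J"
    and "(\<And>r. real k * h \<le> r \<Longrightarrow> r < s \<Longrightarrow> N r = N (real k * h)) \<Longrightarrow> J \<le> exp (2 * \<beta> * h) * V"
proof -
  define c where "c j = exp (- (\<beta> * h * real (Suc k - j)))" for j
  define I where "I j = {real j * h<..real (Suc j) * h}" for j
  define step where "step r = (\<Sum>j<k. c j * indicator (I j) r)" for r :: real
  have I_bounds: "0 \<le> real j * h" "real j * h \<le> real (Suc j) * h" "real (Suc j) * h \<le> T" if "j < k" for j
  proof -
    have "real (Suc j) * h \<le> real k * h" using that h by (intro mult_right_mono) auto
    then show "real (Suc j) * h \<le> T" using s by linarith
  qed (use h in auto)
  have emI: "emeasure dN (I j) = of_nat (N (real (Suc j) * h) - N (real j * h))" if "j < k" for j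
    unfolding I_def by (rule emeasure_dN'[OF I_bounds[OF that]])
  have space_dN: "space dN = UNIV" by (simp add: path_measure_def)
  have sets_I: "I j \<in> sets dN" for j by (simp add: I_def)
  have I_int: "integrable dN (indicator (I j) :: real \<Rightarrow> real)" if "j < k" for j
    using emI[OF that] by (intro integrable_real_indicator sets_I) (simp add: of_nat_less_top)
  have step_int: "integrable dN step" unfolding step_def
    by (intro Bochner_Integration.integrable_sum integrable_mult_right I_int) simp
  have step_eq: "integral\<^sup>L dN step = V"
  proof -
    have "integral\<^sup>L dN step = (\<Sum>j<k. c j * measure dN (I j))" unfolding step_def
      by (subst Bochner_Integration.integral_sum) (auto intro!: integrable_mult_right I_int simp: space_dN)
    also have "\<dots> = V" by (auto simp: V_def c_def measure_def emI intro!: sum.cong)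
    finally show ?thesis .
  qed
  have "emeasure dN {0..<s} \<le> emeasure dN {-1<..s}" by (intro emeasure_mono) auto
  also have "\<dots> < \<infinity>"
  proof -
    have "0 \<le> real k * h" using h by simp
    then have "-1 \<le> s" using s by linarith
    then show ?thesis by (simp add: emeasure_dN)
  qed
  finally have fin: "emeasure dN {0..<s} < \<infinity>" .
  have J_int: "integrable dN (\<lambda>r. indicator {0..<s} r * exp (- \<beta> * (s - r)))"
  proof (rule Bochner_Integration.integrable_bound)
    show "integrable dN (indicator {0..<s} :: real \<Rightarrow> real)" using fin by (intro integrable_real_indicator) auto
    show "AE r in dN. norm (indicator {0..<s} r * exp (- \<beta> * (s - r))) \<le> norm (indicator {0..<s} r :: real)"
      using \<beta> by (intro AE_I2) (auto simp: indicator_def)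
  qed measurable
  have J_eq: "J = integral\<^sup>L dN (\<lambda>r. indicator {0..<s} r * exp (- \<beta> * (s - r)))"
    by (simp add: J_def set_lebesgue_integral_def)
  have step_val: "step r = (if 0 < r \<and> slab_index h r < k then c (slab_index h r) else 0)" for r
  proof -
    have "step r = (\<Sum>j<k. if j = slab_index h r then (if 0 < r then c j else 0) else 0)"
      unfolding step_def
    proof (intro sum.cong refl)
      fix j
      show "c j * indicator (I j) r = (if j = slab_index h r then (if 0 < r then c j else 0) else 0)"
        using slab_index_iff[OF h, of j r] by (auto simp: I_def)
    qed
    then show ?thesis by simp
  qed
  have slabE: "real (slab_index h r) * h < r" "r \<le> real (Suc (slab_index h r)) * h" if "0 < r" for r
    using slab_index_iff[OF h, of "slab_index h r" r] that by auto
  have c_eq: "c j = exp (- (\<beta> * (real (Suc k) * h - real j * h)))" if "j < k" for j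
    using that by (simp add: c_def of_nat_diff algebra_simps)
  have below: "r < s" if "0 < r" "slab_index h r < k" for r
  proof -
    have "real (Suc (slab_index h r)) * h \<le> real k * h" using that h by (intro mult_right_mono) auto
    then show ?thesis using slabE[OF that(1)] s by linarith
  qed
  show "V \<le> J" unfolding step_eq[symmetric] J_eq
  proof (rule integral_mono[OF step_int J_int])
    fix r
    show "step r \<le> indicator {0..<s} r * exp (- \<beta> * (s - r))"
    proof (cases "0 < r \<and> slab_index h r < k")
      case True
      have "\<beta> * (s - r) \<le> \<beta> * (real (Suc k) * h - real (slab_index h r) * h)"
        using \<beta> s slabE[of r] True by (intro mult_left_mono) auto
      then show ?thesis using True below[of r] by (simp add: step_val c_eq)
    qed (auto simp: step_val)
  qed
  \<comment> \<open>\<open>V\<close> leaves out the slab containing s, so the reverse bound needs a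
    path without jumps in that slab before s.\<close>
  assume const: "\<And>r. real k * h \<le> r \<Longrightarrow> r < s \<Longrightarrow> N r = N (real k * h)"
  have "AE r in dN. r \<noteq> 0 \<and> \<not> (real k * h < r \<and> r < s)"
    using h by (intro dN_null[OF s(3) _ const]) auto
  then have "AE r in dN. indicator {0..<s} r * exp (- \<beta> * (s - r)) \<le> exp (2 * \<beta> * h) * step r"
  proof eventually_elim
    case (elim r)
    show ?case
    proof (cases "0 < r \<and> r < s")
      case False
      then have "indicator {0..<s} r = (0 :: real)" using elim by (auto simp: indicator_def)
      then show ?thesis by (simp add: step_val c_def)
    next
      case True
      then have "r \<le> real k * h" using elim by auto
      then have "real (slab_index h r) * h < real k * h" using slabE[of r] True by linarith
      then have i: "slab_index h r < k" using h by simp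
      have "\<beta> * (real (Suc k) * h - real (slab_index h r) * h - 2 * h) \<le> \<beta> * (s - r)"
        using \<beta> s slabE[of r] True by (intro mult_left_mono) (auto simp: algebra_simps)
      then have "exp (- \<beta> * (s - r)) \<le> exp (2 * \<beta> * h + - (\<beta> * (real (Suc k) * h - real (slab_index h r) * h)))"
        by (simp add: algebra_simps)
      then show ?thesis using True i by (simp only: exp_add) (simp add: step_val c_eq)
    qed
  qed
  then show "J \<le> exp (2 * \<beta> * h) * V"
    unfolding step_eq[symmetric] J_eq integral_mult_right_zero[symmetric]
    by (intro integral_mono_AE J_int integrable_mult_right step_int)
qed

end

text \<open>A count in slab \<open>j\<close> is dated to the start of that slab and the kernel is read at the end of the
  current slab, \<open>h (length c + 1 - j)\<close> later; since the kernel decreases in the elapsed time, this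
  underestimates the true intensity.\<close>
definition wt :: "real \<Rightarrow> real \<Rightarrow> nat list \<Rightarrow> real" where
  "wt \<beta> h c = \<beta> * (\<Sum>j<length c. real (c ! j) * exp (- (\<beta> * h * real (Suc (length c) - j))))"

lemma wt_Nil [simp]: "wt \<beta> h [] = 0"
  by (simp add: wt_def)

lemma wt_nonneg: "0 \<le> \<beta> \<Longrightarrow> 0 \<le> wt \<beta> h c"
  by (auto simp: wt_def intro!: mult_nonneg_nonneg sum_nonneg)

text \<open>The exponential kernel turns the weighted sum into a recursion. A fresh count carries
  two decay factors: dated to the start of its slab, it is two mesh widths old when first
  read.\<close>

lemma wt_snoc: "wt \<beta> h (c @ [x]) = exp (- (\<beta> * h)) * (wt \<beta> h c + \<beta> * (exp (- (\<beta> * h)) * real x))"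
proof -
  have "(\<Sum>j<length c. real ((c @ [x]) ! j) * exp (- (\<beta> * h * real (Suc (Suc (length c)) - j))))
      = exp (- (\<beta> * h)) * (\<Sum>j<length c. real (c ! j) * exp (- (\<beta> * h * real (Suc (length c) - j))))"
    unfolding sum_distrib_left
    by (intro sum.cong) (auto simp: nth_append of_nat_diff Suc_diff_le algebra_simps simp flip: exp_add)
  then show ?thesis
    by (simp add: wt_def algebra_simps Suc_diff_le flip: exp_add)
qed

section \<open>The scheme as a function of the two driving measures\<close>

locale hawkes_kernel =
  fixes \<alpha> :: "real \<Rightarrow> real" and \<beta> T :: real
  assumes T: "0 < T" and \<beta>: "0 < \<beta>"
    and \<alpha>_bounds: "0 \<le> \<alpha> x" "\<alpha> x \<le> 1"
    and \<alpha>_antimono: "0 \<le> x \<Longrightarrow> x \<le> x' \<Longrightarrow> x' \<le> 1 \<Longrightarrow> \<alpha> x' \<le> \<alpha> x"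
    and \<alpha>_cont: "isCont \<alpha> x"
begin

text \<open>\<open>\<alpha>\<close> is sampled at the end of the slab, where an antitone function is
  smallest, in keeping with a lower scheme.\<close>

definition lev :: "real \<Rightarrow> real \<Rightarrow> nat list \<Rightarrow> real" where
  "lev \<mu> h c = \<mu> + \<alpha> (real (Suc (length c)) * h / T) * wt \<beta> h c"

definition box :: "real \<Rightarrow> real \<Rightarrow> nat list \<Rightarrow> (real \<times> real) set" where
  "box \<mu> h c = {0..lev \<mu> h c} \<times> {real (length c) * h<..real (Suc (length c)) * h}"

text \<open>Both base rates and both measures are arguments, so the scheme of the second process is
  the same function with the roles exchanged.\<close>

definition ghist where
  "ghist \<mu> \<mu>' h p p' k = hist (box \<mu> h) (box \<mu>' h) p p' k"

definition gbox where
  "gbox \<mu> \<mu>' h p p' k = box \<mu> h (snd (ghist \<mu> \<mu>' h p p' k))"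

definition gcount where
  "gcount \<mu> \<mu>' h p p' k = num_points p (gbox \<mu> \<mu>' h p p' k)"

definition glevel where
  "glevel \<mu> \<mu>' h p p' k = lev \<mu> h (snd (ghist \<mu> \<mu>' h p p' k))"

lemma fst_ghist: "fst (ghist \<mu> \<mu>' h p p' k) = map (gcount \<mu> \<mu>' h p p') [0..<k]"
  by (induction k) (auto simp: ghist_def gcount_def gbox_def Let_def split: prod.splits)

lemma ghist_swap: "ghist \<mu>' \<mu> h p' p k = prod.swap (ghist \<mu> \<mu>' h p p' k)"
  unfolding ghist_def by (rule hist_swap)

lemma snd_ghist: "snd (ghist \<mu> \<mu>' h p p' k) = map (gcount \<mu>' \<mu> h p' p) [0..<k]"
  using fst_ghist[of \<mu>' \<mu> h p' p k] by (simp add: ghist_swap[of \<mu>' \<mu>])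

lemma gbox_eq:
  "gbox \<mu> \<mu>' h p p' k = {0..glevel \<mu> \<mu>' h p p' k} \<times> {real k * h<..real (Suc k) * h}"
  by (simp add: gbox_def box_def glevel_def snd_ghist)

lemma glevel_eq:
  "glevel \<mu> \<mu>' h p p' k = \<mu> + \<alpha> (real (Suc k) * h / T) *
     (\<beta> * (\<Sum>j<k. real (gcount \<mu>' \<mu> h p' p j) * exp (- (\<beta> * h * real (Suc k - j)))))"
  by (simp add: glevel_def lev_def wt_def snd_ghist)

lemma \<alpha>_measurable: "\<alpha> \<in> borel_measurable borel"
  using \<alpha>_cont by (intro borel_measurable_continuous_onI continuous_at_imp_continuous_on) auto

end

section \<open>Pathwise comparison of scheme and process, for one fixed outcome\<close>

locale coupled_paths = hawkes_kernel \<alpha> \<beta> T for \<alpha> \<beta> T +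
  fixes p p' :: "(real \<times> real) measure" and \<mu> \<mu>' :: real and N N' :: "real \<Rightarrow> nat"
  assumes sets_p: "sets p = sets borel" "sets p' = sets borel"
    and integer: "A \<in> sets borel \<Longrightarrow> emeasure p A \<in> range ennreal_of_enat"
      "A \<in> sets borel \<Longrightarrow> emeasure p' A \<in> range ennreal_of_enat"
    and thin: "t \<in> {0..T} \<Longrightarrow> of_nat (N t) = emeasure p (thinning_region (intensity \<mu> \<alpha> \<beta> T N') t)"
      "t \<in> {0..T} \<Longrightarrow> of_nat (N' t) = emeasure p' (thinning_region (intensity \<mu>' \<alpha> \<beta> T N) t)"
begin

lemma coupled_paths_swap: "coupled_paths \<alpha> \<beta> T p' p \<mu>' \<mu> N' N"
  by unfold_locales (use sets_p integer thin in auto)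

abbreviation "l \<equiv> intensity \<mu> \<alpha> \<beta> T N'"
abbreviation "l' \<equiv> intensity \<mu>' \<alpha> \<beta> T N"

sublocale A: thinned_path p l T N
  by unfold_locales (use sets_p thin T intensity_measurable[OF \<alpha>_measurable] in auto)

sublocale A': thinned_path p' l' T N'
  by unfold_locales (use sets_p thin T intensity_measurable[OF \<alpha>_measurable] in auto)

lemma gbox_sets [measurable]: "gbox \<mu> \<mu>' h p p' k \<in> sets borel"
  unfolding gbox_eq borel_prod[symmetric] by (intro pair_measureI) auto

text \<open>The level in slab k reads only counts of the other process in earlier slabs, so
  domination there is what an induction over slabs has to supply.\<close>

lemma intensity_ge_glevel:
  assumes h: "0 < h" and s: "real k * h < s" "s \<le> real (Suc k) * h" "real (Suc k) * h \<le> T"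
    and le: "\<And>j. j < k \<Longrightarrow> gcount \<mu>' \<mu> h p' p j \<le> N' (real (Suc j) * h) - N' (real j * h)"
  shows "glevel \<mu> \<mu>' h p p' k \<le> l s"
proof -
  let ?V = "\<Sum>j<k. real (N' (real (Suc j) * h) - N' (real j * h)) * exp (- (\<beta> * h * real (Suc k - j)))"
  have "0 \<le> real k * h" using h by simp
  then have s': "0 < s" "s \<le> T" using s by linarith+
  have "\<alpha> (real (Suc k) * h / T) * (\<beta> * (\<Sum>j<k. real (gcount \<mu>' \<mu> h p' p j) * exp (- (\<beta> * h * real (Suc k - j)))))
      \<le> \<alpha> (s / T) * (\<beta> * (LINT r:{0..<s}|A'.dN. exp (- \<beta> * (s - r))))"
  proof (intro mult_mono mult_left_mono)
    show "\<alpha> (real (Suc k) * h / T) \<le> \<alpha> (s / T)"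
      using s s' T by (intro \<alpha>_antimono divide_right_mono) auto
    have "(\<Sum>j<k. real (gcount \<mu>' \<mu> h p' p j) * exp (- (\<beta> * h * real (Suc k - j)))) \<le> ?V"
      using le by (intro sum_mono mult_right_mono) auto
    also have "?V \<le> (LINT r:{0..<s}|A'.dN. exp (- \<beta> * (s - r)))"
      using A'.weighted_increments_bounds(1)[OF h \<beta> s(1,2) s'(2)] .
    finally show "(\<Sum>j<k. real (gcount \<mu>' \<mu> h p' p j) * exp (- (\<beta> * h * real (Suc k - j))))
        \<le> (LINT r:{0..<s}|A'.dN. exp (- \<beta> * (s - r)))" .
    show "0 \<le> \<alpha> (s / T)" by (rule \<alpha>_bounds)
    show "0 \<le> \<beta> * (\<Sum>j<k. real (gcount \<mu>' \<mu> h p' p j) * exp (- (\<beta> * h * real (Suc k - j))))"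
      using \<beta> by (auto intro!: mult_nonneg_nonneg sum_nonneg)
  qed (use \<beta> in \<open>auto intro!: sum_nonneg\<close>)
  then show ?thesis by (simp add: glevel_eq intensity_eq mult.assoc)
qed

text \<open>Lying below the true intensity, the box is part of the thinned region of its slab. This
  bounds its count by the increment and, increments being finite, rules out the default 0 of an
  infinite count.\<close>

lemma gbox_count:
  assumes h: "0 < h" and k: "real (Suc k) * h \<le> T"
    and le: "\<And>j. j < k \<Longrightarrow> gcount \<mu>' \<mu> h p' p j \<le> N' (real (Suc j) * h) - N' (real j * h)"
  shows "emeasure p (gbox \<mu> \<mu>' h p p' k) = of_nat (gcount \<mu> \<mu>' h p p' k)"
    and "gcount \<mu> \<mu>' h p p' k \<le> N (real (Suc k) * h) - N (real k * h)"
proof -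
  have k0: "0 \<le> real k * h" "real k * h \<le> real (Suc k) * h" using h by auto
  have "gbox \<mu> \<mu>' h p p' k \<subseteq> thinning_region l (real (Suc k) * h) - thinning_region l (real k * h)"
  proof
    fix z assume "z \<in> gbox \<mu> \<mu>' h p p' k"
    then obtain x s where z: "z = (x, s)" "0 \<le> x" "x \<le> glevel \<mu> \<mu>' h p p' k" "real k * h < s" "s \<le> real (Suc k) * h"
      by (auto simp: gbox_eq)
    moreover have "glevel \<mu> \<mu>' h p p' k \<le> l s" by (rule intensity_ge_glevel[OF h z(4,5) k le])
    ultimately show "z \<in> thinning_region l (real (Suc k) * h) - thinning_region l (real k * h)"
      using k0 by (auto simp: thinning_region_def)
  qed
  then have "emeasure p (gbox \<mu> \<mu>' h p p' k)
      \<le> emeasure p (thinning_region l (real (Suc k) * h) - thinning_region l (real k * h))"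
    by (intro emeasure_mono sets.Diff A.region_sets)
  also have "\<dots> = of_nat (N (real (Suc k) * h) - N (real k * h))"
    by (rule A.emeasure_increment(1)[OF k0 k])
  finally have *: "emeasure p (gbox \<mu> \<mu>' h p p' k) \<le> of_nat (N (real (Suc k) * h) - N (real k * h))" .
  then have "emeasure p (gbox \<mu> \<mu>' h p p' k) < \<infinity>"
    by (rule le_less_trans) (simp add: of_nat_less_top)
  then show eq: "emeasure p (gbox \<mu> \<mu>' h p p' k) = of_nat (gcount \<mu> \<mu>' h p p' k)"
    unfolding gcount_def by (intro emeasure_eq_num_points integer gbox_sets)
  show "gcount \<mu> \<mu>' h p p' k \<le> N (real (Suc k) * h) - N (real k * h)"
    using * unfolding eq by simp
qed

text \<open>The two inequalities share one strong induction, because each process reads the earlier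
  counts of the other.\<close>

lemma gcount_le_increment:
  assumes h: "0 < h"
  shows "real (Suc k) * h \<le> T \<Longrightarrow> gcount \<mu> \<mu>' h p p' k \<le> N (real (Suc k) * h) - N (real k * h) \<and>
    gcount \<mu>' \<mu> h p' p k \<le> N' (real (Suc k) * h) - N' (real k * h)"
proof (induction k rule: less_induct)
  case (less k)
  have j: "real (Suc j) * h \<le> T" if "j < k" for j
  proof -
    have "real (Suc j) * h \<le> real (Suc k) * h" using that h by (intro mult_right_mono) auto
    then show ?thesis using less.prems by linarith
  qed
  interpret S: coupled_paths \<alpha> \<beta> T p' p \<mu>' \<mu> N' N by (rule coupled_paths_swap)
  show ?case
    using gbox_count(2)[OF h less.prems] S.gbox_count(2)[OF h less.prems] less.IH j by blast
qed

lemma emeasure_gbox: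
  assumes h: "0 < h" and k: "real (Suc k) * h \<le> T"
  shows "emeasure p (gbox \<mu> \<mu>' h p p' k) = of_nat (gcount \<mu> \<mu>' h p p' k)"
proof (rule gbox_count[OF h k])
  fix j assume "j < k"
  then have "real (Suc j) * h \<le> real (Suc k) * h" using h by (intro mult_right_mono) auto
  then show "gcount \<mu>' \<mu> h p' p j \<le> N' (real (Suc j) * h) - N' (real j * h)"
    using gcount_le_increment[OF h, of j] k by linarith
qed

lemma glevel_le_intensity:
  assumes h: "0 < h" and s: "real k * h < s" "s \<le> real (Suc k) * h" "real (Suc k) * h \<le> T"
  shows "glevel \<mu> \<mu>' h p p' k \<le> l s"
proof (rule intensity_ge_glevel[OF h s])
  fix j assume "j < k"
  then have "real (Suc j) * h \<le> real (Suc k) * h" using h by (intro mult_right_mono) auto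
  then show "gcount \<mu>' \<mu> h p' p j \<le> N' (real (Suc j) * h) - N' (real j * h)"
    using gcount_le_increment[OF h, of j] s by linarith
qed

lemma sum_gcount_le:
  assumes h: "0 < h" shows "real n * h \<le> T \<Longrightarrow> (\<Sum>k<n. gcount \<mu> \<mu>' h p p' k) \<le> N (real n * h)"
proof (induction n)
  case (Suc n)
  have le: "real n * h \<le> real (Suc n) * h" using h by simp
  have "N (real n * h) \<le> N (real (Suc n) * h)"
    using h Suc.prems by (intro A.emeasure_increment(2) le) auto
  moreover have "gcount \<mu> \<mu>' h p p' n \<le> N (real (Suc n) * h) - N (real n * h)"
    using gcount_le_increment[OF h Suc.prems] by blast
  moreover have "(\<Sum>k<n. gcount \<mu> \<mu>' h p p' k) \<le> N (real n * h)"
    using Suc.prems le by (intro Suc.IH) linarith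
  ultimately show ?case by simp
qed simp

text \<open>Boxes of all n slabs are removed, also those after t, so that passing to a later time
  only adds points in between.\<close>

definition missed :: "real \<Rightarrow> nat \<Rightarrow> real \<Rightarrow> (real \<times> real) set" where
  "missed h n t = thinning_region l t - (\<Union>k<n. gbox \<mu> \<mu>' h p p' k)"

lemma missed_sets [measurable]: "missed h n t \<in> sets borel"
  unfolding missed_def using A.region_sets by (auto intro!: sets.Diff sets.finite_UN)

lemma missed_subset: "missed h n t \<subseteq> thinning_region l t"
  by (auto simp: missed_def)

text \<open>A point of slab j lies in the box, is missed, or comes after s; the last kind is absent
  because the path does not change between s and t. Separating s from t lets the grid time t vary
  with the mesh while the time s, up to which nothing is missed, stays fixed.\<close>

lemma gcount_eq_increment:
  assumes h: "0 < h" and j: "j < n" "real (Suc j) * h \<le> t" "t \<le> T"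
    and null: "emeasure p (missed h n s) = 0" and s: "0 \<le> s" "s \<le> t" "N t = N s"
  shows "gcount \<mu> \<mu>' h p p' j = N (real (Suc j) * h) - N (real j * h)"
proof -
  let ?b = "real (Suc j) * h" and ?a = "real j * h"
  have ab: "0 \<le> ?a" "?a \<le> ?b" "?b \<le> T" using h j by auto
  have cover: "thinning_region l ?b - thinning_region l ?a
      \<subseteq> gbox \<mu> \<mu>' h p p' j \<union> missed h n s \<union> (thinning_region l t - thinning_region l s)"
  proof
    fix z assume "z \<in> thinning_region l ?b - thinning_region l ?a"
    then obtain x r where z: "z = (x, r)" "0 \<le> x" "x \<le> l r" "?a < r" "r \<le> ?b"
      using ab by (cases z) (auto simp: thinning_region_def not_le)
    then have r0: "0 < r" using ab by linarith
    show "z \<in> gbox \<mu> \<mu>' h p p' j \<union> missed h n s \<union> (thinning_region l t - thinning_region l s)"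
    proof (cases "r \<le> s \<and> z \<notin> gbox \<mu> \<mu>' h p p' j")
      case True
      \<comment> \<open>Slabs are disjoint in time, so a point of slab j could only be caught by box
        j.\<close>
      have "z \<notin> gbox \<mu> \<mu>' h p p' i" for i
      proof
        assume z': "z \<in> gbox \<mu> \<mu>' h p p' i"
        then have "slab_index h r = i"
          using slab_index_iff[OF h, of i r] by (auto simp: gbox_eq z(1))
        moreover have "slab_index h r = j" using slab_index_iff[OF h, of j r] z by auto
        ultimately show False using z' True by simp
      qed
      then show ?thesis using z True r0 by (auto simp: missed_def thinning_region_def)
    next
      case False
      then show ?thesis using z r0 j by (auto simp: thinning_region_def)
    qed
  qed
  have "of_nat (N ?b - N ?a) = emeasure p (thinning_region l ?b - thinning_region l ?a)"
    using A.emeasure_increment(1)[OF ab] by simp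
  also have "\<dots> \<le> emeasure p (gbox \<mu> \<mu>' h p p' j \<union> missed h n s \<union> (thinning_region l t - thinning_region l s))"
    using gbox_sets missed_sets A.region_sets by (intro emeasure_mono cover sets.Un sets.Diff) auto
  also have "\<dots> \<le> emeasure p (gbox \<mu> \<mu>' h p p' j) + emeasure p (missed h n s)
      + emeasure p (thinning_region l t - thinning_region l s)"
    using gbox_sets missed_sets A.region_sets
    by (intro order_trans[OF emeasure_subadditive] add_right_mono emeasure_subadditive sets.Un sets.Diff) auto
  also have "\<dots> = of_nat (gcount \<mu> \<mu>' h p p' j)"
    using A.emeasure_increment(1)[OF s(1,2) j(3)] s(3) by (simp add: null emeasure_gbox[OF h ab(3)])
  finally have "N ?b - N ?a \<le> gcount \<mu> \<mu>' h p p' j" by simp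
  then show ?thesis using gcount_le_increment[OF h ab(3)] by simp
qed

end

section \<open>Convergence of the lower scheme\<close>

lemma slab_index_bounds:
  assumes "0 < h" "0 < s"
  shows "real (slab_index h s) * h < s" "s \<le> real (Suc (slab_index h s)) * h"
  using slab_index_iff[OF assms(1), of "slab_index h s" s] assms(2) by auto

lemma slab_index_less:
  assumes "0 < h" "0 < s" "s \<le> real n * h"
  shows "slab_index h s < n"
proof -
  have "real (slab_index h s) * h < real n * h"
    using slab_index_bounds[OF assms(1,2)] assms(3) by linarith
  then show ?thesis using assms(1) by simp
qed

lemma slab_index_tendsto:
  assumes h: "\<And>n. 0 < h n" "h \<longlonglongrightarrow> 0" and s: "0 < s"
  shows "(\<lambda>n. real (slab_index (h n) s) * h n) \<longlonglongrightarrow> s"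
    and "(\<lambda>n. real (Suc (slab_index (h n) s)) * h n) \<longlonglongrightarrow> s"
proof -
  have b: "real (slab_index (h n) s) * h n < s" "s \<le> real (slab_index (h n) s) * h n + h n" for n
    using slab_index_bounds[OF h(1) s, of n] by (auto simp: algebra_simps)
  have lim: "(\<lambda>n. s - h n) \<longlonglongrightarrow> s" "(\<lambda>n. s + h n) \<longlonglongrightarrow> s"
    using tendsto_diff[OF tendsto_const h(2), of s] tendsto_add[OF tendsto_const h(2), of s] by simp_all
  show 1: "(\<lambda>n. real (slab_index (h n) s) * h n) \<longlonglongrightarrow> s"
    by (rule tendsto_sandwich[OF _ _ lim(1) tendsto_const])
       (use b in \<open>auto intro!: always_eventually simp: algebra_simps less_imp_le\<close>)
  show "(\<lambda>n. real (Suc (slab_index (h n) s)) * h n) \<longlonglongrightarrow> s"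
    using tendsto_add[OF 1 h(2)] by (simp add: algebra_simps)
qed

text \<open>The horizon \<open>\<tau>\<close> is a point of every grid. Points on the graph are
  excluded in terms of the limit of the levels of the scheme, near whose graphs the mean number of
  points can be computed; \<open>glevel_tendsto\<close> identifies that limit with the
  intensity.\<close>

locale grid_limit = coupled_paths +
  fixes \<tau> :: real and h :: "nat \<Rightarrow> real"
  assumes \<tau>: "0 < \<tau>" "\<tau> \<le> T"
  defines "h \<equiv> \<lambda>n. \<tau> / real (Suc n)"
  assumes no_boundary_points:
    "AE (x, s) in p. \<not> (0 < s \<and> s \<le> \<tau> \<and> (\<lambda>n. glevel \<mu> \<mu>' (h n) p p' (slab_index (h n) s)) \<longlonglongrightarrow> x)"
    "AE (x, s) in p'. \<not> (0 < s \<and> s \<le> \<tau> \<and> (\<lambda>n. glevel \<mu>' \<mu> (h n) p' p (slab_index (h n) s)) \<longlonglongrightarrow> x)"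
begin

lemma grid_limit_swap: "grid_limit \<alpha> \<beta> T p' p \<mu>' \<mu> N' N \<tau>"
  using coupled_paths_swap \<tau> no_boundary_points
  by (simp add: grid_limit_def grid_limit_axioms_def h_def)

sublocale S: coupled_paths \<alpha> \<beta> T p' p \<mu>' \<mu> N' N
  by (rule coupled_paths_swap)

lemma h: "0 < h n" "real (Suc n) * h n = \<tau>" "h \<longlonglongrightarrow> 0"
proof -
  show "0 < h n" "real (Suc n) * h n = \<tau>" using \<tau> by (auto simp: h_def)
  show "h \<longlonglongrightarrow> 0" unfolding h_def by real_asymp
qed

definition good where
  "good t \<longleftrightarrow> (\<forall>\<^sub>F n in sequentially. emeasure p (missed (h n) (Suc n) t) = 0)"

definition good' where
  "good' t \<longleftrightarrow> (\<forall>\<^sub>F n in sequentially. emeasure p' (S.missed (h n) (Suc n) t) = 0)"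

text \<open>A sandwich: domination is the upper bound, and the lower one loses a factor exp (2 beta
  h) in the excitation. Goodness strictly before s is the right hypothesis because the intensity
  integrates over [0, s).\<close>

lemma glevel_tendsto:
  assumes s: "0 < s" "s \<le> \<tau>" and good: "\<And>r. 0 \<le> r \<Longrightarrow> r < s \<Longrightarrow> good' r"
  shows "(\<lambda>n. glevel \<mu> \<mu>' (h n) p p' (slab_index (h n) s)) \<longlonglongrightarrow> l s"
proof -
  define k where "k n = slab_index (h n) s" for n
  define J where "J = (LINT r:{0..<s}|A'.dN. exp (- \<beta> * (s - r)))"
  have sT: "s \<le> T" using s \<tau> by simp
  \<comment> \<open>After s' there is no jump of N' before s. Goodness at this single time therefore
    controls all slabs that enter the level, as soon as the current slab starts after s'.\<close>
  obtain s' where s': "0 \<le> s'" "s' < s" "\<And>r. s' \<le> r \<Longrightarrow> r < s \<Longrightarrow> N' r = N' s'"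
    using A'.N_left_constant[OF s(1) sT] by blast
  have k: "real (k n) * h n < s" "s \<le> real (Suc (k n)) * h n" "k n < Suc n" for n
    using slab_index_bounds[OF h(1) s(1)] slab_index_less[OF h(1) s(1), of "Suc n" n] h(2)[of n] s
    by (auto simp: k_def)
  have kT: "real (Suc (k n)) * h n \<le> T" for n
  proof -
    have "real (Suc (k n)) * h n \<le> real (Suc n) * h n"
      using k(3)[of n] h(1)[of n] by (intro mult_right_mono) auto
    then show ?thesis using h(2)[of n] \<tau> by simp
  qed
  note lim = slab_index_tendsto[OF h(1,3) s(1), folded k_def]
  have upper: "glevel \<mu> \<mu>' (h n) p p' (k n) \<le> l s" for n
    by (rule glevel_le_intensity[OF h(1) k(1,2) kT])
  have ev: "\<forall>\<^sub>F n in sequentially. s' < real (k n) * h n"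
    using lim(1) s'(2) by (rule order_tendstoD)
  have lower: "\<forall>\<^sub>F n in sequentially.
      \<mu> + \<alpha> (real (Suc (k n)) * h n / T) * (\<beta> * (exp (- (2 * \<beta> * h n)) * J)) \<le> glevel \<mu> \<mu>' (h n) p p' (k n)"
    using ev good[unfolded good'_def, OF s'(1,2)]
  proof eventually_elim
    case (elim n)
    let ?V = "\<Sum>j<k n. real (N' (real (Suc j) * h n) - N' (real j * h n)) * exp (- (\<beta> * h n * real (Suc (k n) - j)))"
    have V: "(\<Sum>j<k n. real (gcount \<mu>' \<mu> (h n) p' p j) * exp (- (\<beta> * h n * real (Suc (k n) - j)))) = ?V"
    proof (intro sum.cong refl arg_cong2[where f="(*)"] arg_cong[where f=real])
      fix j assume j: "j \<in> {..<k n}"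
      have "real (Suc j) * h n \<le> real (k n) * h n" using j h(1)[of n] by (intro mult_right_mono) auto
      moreover have "j < Suc n" using j k(3)[of n] by simp
      moreover have "real (k n) * h n \<le> T" using k(1)[of n] sT by linarith
      moreover have "N' (real (k n) * h n) = N' s'" using elim(1) k(1)[of n] by (intro s'(3)) auto
      ultimately show "gcount \<mu>' \<mu> (h n) p' p j = N' (real (Suc j) * h n) - N' (real j * h n)"
        using S.gcount_eq_increment[OF h(1) _ _ _ elim(2) s'(1)] elim(1) by simp
    qed
    have "J \<le> exp (2 * \<beta> * h n) * ?V" unfolding J_def
    proof (rule A'.weighted_increments_bounds(2)[OF h(1) \<beta> k(1,2) sT])
      fix r assume "real (k n) * h n \<le> r" "r < s"
      then show "N' r = N' (real (k n) * h n)"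
        using s'(3)[of r] s'(3)[of "real (k n) * h n"] elim k(1)[of n] by simp
    qed
    then have "exp (- (2 * \<beta> * h n)) * J \<le> exp (- (2 * \<beta> * h n)) * (exp (2 * \<beta> * h n) * ?V)"
      by (intro mult_left_mono) auto
    also have "\<dots> = ?V" by (simp add: mult.assoc[symmetric] flip: exp_add)
    finally have *: "exp (- (2 * \<beta> * h n)) * J \<le> ?V" .
    have "0 \<le> \<alpha> (real (Suc (k n)) * h n / T)" by (rule \<alpha>_bounds)
    then show ?case unfolding glevel_eq V using * \<beta> by (intro add_left_mono mult_left_mono) auto
  qed
  have "(\<lambda>n. \<mu> + \<alpha> (real (Suc (k n)) * h n / T) * (\<beta> * (exp (- (2 * \<beta> * h n)) * J)))
      \<longlonglongrightarrow> \<mu> + \<alpha> (s / T) * (\<beta> * (exp (- (2 * \<beta> * 0)) * J))"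
    using T by (intro tendsto_intros h(3) isCont_tendsto_compose[OF \<alpha>_cont] lim(2)) auto
  also have "\<mu> + \<alpha> (s / T) * (\<beta> * (exp (- (2 * \<beta> * 0)) * J)) = l s"
    by (simp add: intensity_eq J_def mult.assoc)
  finally have "(\<lambda>n. glevel \<mu> \<mu>' (h n) p p' (k n)) \<longlonglongrightarrow> l s"
    using upper by (intro tendsto_sandwich[OF lower _ _ tendsto_const]) auto
  then show ?thesis by (simp add: k_def)
qed

text \<open>A point (x, r) of the region with x < l r is eventually inside a box, and x = l r is
  excluded. Dominated convergence over the region, which has finite mass, sends the missed mass to
  0; being an integer, it vanishes from some index on.\<close>

lemma good_limit:
  assumes s: "0 \<le> s" "s \<le> \<tau>" and good: "\<And>r. 0 \<le> r \<Longrightarrow> r < s \<Longrightarrow> good' r"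
  shows "good s"
proof -
  let ?R = "\<lambda>n. missed (h n) (Suc n) s"
  have fin: "emeasure p (thinning_region l s) = of_nat (N s)" using s \<tau> by (intro A.thinning[symmetric]) auto
  have "(\<lambda>n. \<integral>\<^sup>+z. indicator (?R n) z \<partial>p) \<longlonglongrightarrow> (\<integral>\<^sup>+z. 0 \<partial>p)"
  proof (rule nn_integral_dominated_convergence[where w="indicator (thinning_region l s)"])
    show "(\<integral>\<^sup>+z. indicator (thinning_region l s) z \<partial>p) < \<infinity>"
      by (subst nn_integral_indicator[OF A.region_sets]) (simp add: fin of_nat_less_top)
    show "AE z in p. indicator (?R j) z \<le> (indicator (thinning_region l s) z :: ennreal)" for j
      using subsetD[OF missed_subset] by (intro AE_I2) (auto simp: indicator_def)
    show "AE z in p. (\<lambda>n. indicator (?R n) z :: ennreal) \<longlonglongrightarrow> 0"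
      using no_boundary_points(1)
    proof eventually_elim
      case (elim z)
      obtain x r where z: "z = (x, r)" by (cases z)
      have "\<forall>\<^sub>F n in sequentially. z \<notin> ?R n"
      proof (cases "z \<in> thinning_region l s")
        case False
        then show ?thesis using missed_subset by (intro always_eventually) blast
      next
        case True
        then have r: "0 \<le> x" "x \<le> l r" "0 < r" "r \<le> s" by (auto simp: z thinning_region_def)
        have lim: "(\<lambda>n. glevel \<mu> \<mu>' (h n) p p' (slab_index (h n) r)) \<longlonglongrightarrow> l r"
          using r s by (intro glevel_tendsto good) auto
        with elim r s have "x \<noteq> l r" by (auto simp: z)
        with r have "x < l r" by simp
        with lim have "\<forall>\<^sub>F n in sequentially. x < glevel \<mu> \<mu>' (h n) p p' (slab_index (h n) r)"
          by (rule order_tendstoD)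
        then show ?thesis
        proof eventually_elim
          case (elim n)
          have "slab_index (h n) r < Suc n"
            using r s h(2)[of n] by (intro slab_index_less h(1)) auto
          moreover have "z \<in> gbox \<mu> \<mu>' (h n) p p' (slab_index (h n) r)"
            using elim r slab_index_bounds[OF h(1) r(3), of n] by (auto simp: z gbox_eq)
          ultimately show ?case by (auto simp: missed_def)
        qed
      qed
      then show ?case
        by (intro tendsto_eventually) (auto elim!: eventually_mono simp: indicator_def)
    qed
  qed auto
  then have "(\<lambda>n. emeasure p (?R n)) \<longlonglongrightarrow> 0" by simp
  then have "\<forall>\<^sub>F n in sequentially. emeasure p (?R n) < 1"
    by (rule order_tendstoD) simp
  then show ?thesis unfolding good_def
  proof eventually_elim
    case (elim n)
    obtain e where e: "emeasure p (?R n) = ennreal_of_enat e"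
      using integer(1)[OF missed_sets, of "h n" "Suc n" s] by auto
    with elim have "e < 1" by (metis ennreal_of_enat_1 ennreal_of_enat_le_iff linorder_not_le)
    then have "e = 0" by (cases e) (auto simp: one_enat_def zero_enat_def)
    then show ?case using e by simp
  qed
qed

lemma good_extend:
  assumes t: "good t" "0 \<le> t" "t \<le> r" "r \<le> T" and const: "N r = N t"
  shows "good r"
proof -
  have "emeasure p (missed (h n) (Suc n) r) \<le> emeasure p (missed (h n) (Suc n) t)" for n
  proof -
    have "emeasure p (missed (h n) (Suc n) r)
        \<le> emeasure p (missed (h n) (Suc n) t \<union> (thinning_region l r - thinning_region l t))"
      using missed_sets A.region_sets
      by (intro emeasure_mono sets.Un sets.Diff) (auto simp: missed_def)
    also have "\<dots> \<le> emeasure p (missed (h n) (Suc n) t) + emeasure p (thinning_region l r - thinning_region l t)"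
      using missed_sets A.region_sets by (intro emeasure_subadditive sets.Diff) auto
    also have "emeasure p (thinning_region l r - thinning_region l t) = 0"
      using A.emeasure_increment(1)[OF t(2-4)] const by simp
    finally show ?thesis by simp
  qed
  then show ?thesis using t(1) unfolding good_def
    by (auto elim!: eventually_mono) (metis le_zero_eq)
qed

text \<open>Real induction: \<open>good_limit\<close> passes to the supremum of the good times, and integer-valued
  right-continuous paths stay constant for a while after it.\<close>
lemma all_good:
  assumes "0 \<le> t" "t \<le> \<tau>"
  shows "good t \<and> good' t"
proof (rule ccontr)
  assume bad: "\<not> (good t \<and> good' t)"
  interpret L: grid_limit \<alpha> \<beta> T p' p \<mu>' \<mu> N' N \<tau> h
    unfolding h_def by (rule grid_limit_swap)
  have L_good: "L.good = good'" "L.good' = good"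
    by (auto simp: fun_eq_iff L.good_def good'_def L.good'_def good_def)
  define Z where "Z = {t. 0 \<le> t \<and> t \<le> \<tau> \<and> \<not> (good t \<and> good' t)}"
  define \<sigma> where "\<sigma> = Inf Z"
  have tZ: "t \<in> Z" using bad assms by (simp add: Z_def)
  have bdd: "bdd_below Z" by (rule bdd_belowI[of _ 0]) (simp add: Z_def)
  have "\<sigma> \<le> t" unfolding \<sigma>_def by (rule cInf_lower[OF tZ bdd])
  moreover have "0 \<le> \<sigma>" unfolding \<sigma>_def by (rule cInf_greatest) (use tZ in \<open>auto simp: Z_def\<close>)
  ultimately have \<sigma>: "0 \<le> \<sigma>" "\<sigma> \<le> \<tau>" using assms by auto
  have below: "good r \<and> good' r" if "0 \<le> r" "r < \<sigma>" for r
  proof -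
    have "r \<notin> Z" using cInf_lower[OF _ bdd, of r] that by (auto simp: \<sigma>_def)
    then show ?thesis using that \<sigma> by (auto simp: Z_def)
  qed
  have good\<sigma>: "good \<sigma>" "good' \<sigma>"
    using good_limit[OF \<sigma>] L.good_limit[OF \<sigma>] below by (auto simp: L_good)
  obtain \<delta> where \<delta>: "0 < \<delta>" "\<And>r. \<sigma> \<le> r \<Longrightarrow> r < \<sigma> + \<delta> \<Longrightarrow> r \<le> \<tau> \<Longrightarrow> good r \<and> good' r"
  proof (cases "\<sigma> < T")
    case True
    obtain d where d: "0 < d" "\<sigma> + d \<le> T" "\<And>r. \<sigma> \<le> r \<Longrightarrow> r \<le> \<sigma> + d \<Longrightarrow> N r = N \<sigma>"
      using A.N_right_constant[OF \<sigma>(1) True] by blast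
    obtain d' where d': "0 < d'" "\<sigma> + d' \<le> T" "\<And>r. \<sigma> \<le> r \<Longrightarrow> r \<le> \<sigma> + d' \<Longrightarrow> N' r = N' \<sigma>"
      using A'.N_right_constant[OF \<sigma>(1) True] by blast
    show ?thesis
    proof (rule that[of "min d d'"])
      fix r assume r: "\<sigma> \<le> r" "r < \<sigma> + min d d'" "r \<le> \<tau>"
      show "good r \<and> good' r"
        using good_extend[OF good\<sigma>(1) \<sigma>(1) r(1)] L.good_extend[unfolded L_good, OF good\<sigma>(2) \<sigma>(1) r(1)]
          d(3)[of r] d'(3)[of r] r \<tau> by auto
    qed (use d d' in auto)
  next
    \<comment> \<open>Now sigma = tau = T, no later time remains, and any positive delta will
      do.\<close>
    case False
    then have "r = \<sigma>" if "\<sigma> \<le> r" "r \<le> \<tau>" for r using that \<tau> by simp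
    then show ?thesis using good\<sigma> that[of 1] by auto
  qed
  have "\<sigma> + \<delta> \<le> \<sigma>" unfolding \<sigma>_def
  proof (rule cInf_greatest)
    fix r assume r: "r \<in> Z"
    then have "\<sigma> \<le> r" unfolding \<sigma>_def by (rule cInf_lower[OF _ bdd])
    then show "Inf Z + \<delta> \<le> r" using \<delta>(2)[of r] r by (force simp: Z_def \<sigma>_def)
  qed (use tZ in auto)
  then show False using \<delta>(1) by simp
qed

text \<open>Domination is one inequality. For the other, the region up to \<open>\<tau>\<close> is
  covered by the boxes and the missed set, which eventually carries no point.\<close>

theorem sum_gcount_eventually_eq:
  "\<forall>\<^sub>F n in sequentially. (\<Sum>k<Suc n. gcount \<mu> \<mu>' (h n) p p' k) = N \<tau>"
proof -
  have "good \<tau>" using all_good[of \<tau>] \<tau> by simp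
  then show ?thesis unfolding good_def
  proof eventually_elim
    case (elim n)
    have hT: "real (Suc n) * h n \<le> T" using h(2)[of n] \<tau> by simp
    have "of_nat (N \<tau>) = emeasure p (thinning_region l \<tau>)" using \<tau> by (intro A.thinning) auto
    also have "\<dots> \<le> emeasure p (missed (h n) (Suc n) \<tau> \<union> (\<Union>k<Suc n. gbox \<mu> \<mu>' (h n) p p' k))"
      by (intro emeasure_mono sets.Un sets.finite_UN) (auto simp: missed_def[of _ "Suc n"], use missed_sets missed_def in auto)
    also have "\<dots> \<le> emeasure p (missed (h n) (Suc n) \<tau>) + emeasure p (\<Union>k<Suc n. gbox \<mu> \<mu>' (h n) p p' k)"
      by (intro emeasure_subadditive sets.finite_UN) auto
    also have "\<dots> \<le> 0 + (\<Sum>k<Suc n. emeasure p (gbox \<mu> \<mu>' (h n) p p' k))"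
      using elim by (intro add_mono emeasure_subadditive_finite) auto
    also have "(\<Sum>k<Suc n. emeasure p (gbox \<mu> \<mu>' (h n) p p' k)) = (\<Sum>k<Suc n. of_nat (gcount \<mu> \<mu>' (h n) p p' k))"
    proof (intro sum.cong refl emeasure_gbox h(1))
      fix k assume "k \<in> {..<Suc n}"
      then have "real (Suc k) * h n \<le> real (Suc n) * h n" using h(1)[of n] by (intro mult_right_mono) auto
      then show "real (Suc k) * h n \<le> T" using hT by linarith
    qed
    finally have "N \<tau> \<le> (\<Sum>k<Suc n. gcount \<mu> \<mu>' (h n) p p' k)"
      by (simp only: add_0 of_nat_sum[symmetric] of_nat_le_iff)
    moreover have "(\<Sum>k<Suc n. gcount \<mu> \<mu>' (h n) p p' k) \<le> N \<tau>"
      using sum_gcount_le[OF h(1) hT] h(2)[of n] by simp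
    ultimately show ?case by simp
  qed
qed

end

section \<open>Means of the lower scheme\<close>

lemma emeasure_lborel_slab_box:
  fixes a b c d :: real
  assumes "a \<le> b" "c \<le> d"
  shows "emeasure lborel ({a..b} \<times> {c<..d}) = ennreal ((b - a) * (d - c))"
proof -
  have "emeasure (lborel \<Otimes>\<^sub>M lborel) ({a..b} \<times> {c<..d}) = emeasure lborel {a..b} * emeasure lborel {c<..d}"
    by (rule lborel.emeasure_pair_measure_Times) auto
  then show ?thesis using assms by (simp add: lborel_prod ennreal_mult)
qed

locale hawkes_prms = hawkes_kernel \<alpha> \<beta> T + independent_prms M lborel \<pi> \<pi>'
  for \<alpha> :: "real \<Rightarrow> real" and \<beta> T :: real and M :: "'a measure" and \<pi> \<pi>' :: "'a \<Rightarrow> (real \<times> real) measure" +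
  fixes \<mu> \<mu>' :: real
  assumes \<mu>: "0 \<le> \<mu>" "0 \<le> \<mu>'"
begin

lemma hawkes_prms_swap: "hawkes_prms \<alpha> \<beta> T M \<pi>' \<pi> \<mu>' \<mu>"
  using hawkes_kernel_axioms independent_prms_swap \<mu> by (simp add: hawkes_prms_def hawkes_prms_axioms_def)

definition slab :: "real \<Rightarrow> nat \<Rightarrow> (real \<times> real) set" where
  "slab h j = UNIV \<times> {real j * h<..real (Suc j) * h}"

lemma strip_sets: "{x..y} \<times> {real j * h<..real (Suc j) * h} \<in> sets (lborel :: (real \<times> real) measure)"
  unfolding sets_lborel borel_prod[symmetric] by (intro pair_measureI) auto

lemma prm_scheme_box:
  assumes h: "0 < h"
  shows "prm_scheme M lborel \<pi> \<pi>' (slab h) (box \<mu> h) (box \<mu>' h)"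
proof
  show "disjoint_family (slab h)"
    unfolding disjoint_family_on_def
  proof (intro ballI impI)
    have "slab_index h (snd z) = i" if "z \<in> slab h i" for z i
      using that slab_index_iff[OF h, of i "snd z"] by (auto simp: slab_def)
    then show "slab h i \<inter> slab h j = {}" if "i \<noteq> j" for i j
      using that by blast
  qed
  show "box \<mu> h c \<in> sets lborel" "box \<mu>' h c \<in> sets lborel" for c
    unfolding box_def by (rule strip_sets)+
qed (auto simp: box_def slab_def)

abbreviation "G h k \<omega> \<equiv> ghist \<mu> \<mu>' h (\<pi> \<omega>) (\<pi>' \<omega>) k"

lemma ghist_measurable [measurable]:
  assumes "0 < h" shows "G h k \<in> measurable M (count_space UNIV)"
  unfolding ghist_def by (rule prm_scheme.hist_measurable[OF prm_scheme_box[OF assms]])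

lemma gcount_measurable [measurable]:
  assumes "0 < h"
  shows "(\<lambda>\<omega>. gcount \<mu> \<mu>' h (\<pi> \<omega>) (\<pi>' \<omega>) k) \<in> measurable M (count_space UNIV)"
proof -
  have "gcount \<mu> \<mu>' h (\<pi> \<omega>) (\<pi>' \<omega>) k = fst (G h (Suc k) \<omega>) ! k" for \<omega>
    by (simp only: fst_ghist) (simp add: nth_append)
  then show ?thesis
    using measurable_compose[OF ghist_measurable[OF assms, where k="Suc k"], where g="\<lambda>c. fst c ! k" and L="count_space UNIV"]
    by simp
qed

text \<open>General edges serve two purposes: 0 and the level give the mean count of a box, the
  level minus and plus epsilon the points near its upper edge.\<close>

lemma mean_strip:
  fixes lo hi :: "nat list \<Rightarrow> real"
  assumes h: "0 < h" and le: "\<And>c. lo c \<le> hi c"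
  defines "S \<equiv> \<lambda>c. {lo c..hi c} \<times> {real (length c) * h<..real (Suc (length c)) * h}"
  shows "(\<lambda>\<omega>. emeasure (\<pi> \<omega>) (S (snd (G h k \<omega>)))) \<in> borel_measurable M"
    and "(\<integral>\<^sup>+\<omega>. emeasure (\<pi> \<omega>) (S (snd (G h k \<omega>))) \<partial>M)
      = (\<integral>\<^sup>+\<omega>. ennreal ((hi (snd (G h k \<omega>)) - lo (snd (G h k \<omega>))) * h) \<partial>M)"
proof -
  interpret P: prm_scheme M lborel \<pi> \<pi>' "slab h" "box \<mu> h" "box \<mu>' h"
    by (rule prm_scheme_box[OF h])
  have em: "emeasure lborel (S c) = ennreal ((hi c - lo c) * h)" for c
    unfolding S_def using h le by (subst emeasure_lborel_slab_box) (auto simp: algebra_simps)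
  have S: "S c \<in> sets lborel" "S c \<subseteq> slab h (length c)" "emeasure lborel (S c) < \<infinity>" for c
  proof -
    show "S c \<in> sets lborel" unfolding S_def by (rule strip_sets)
  qed (auto simp: em, auto simp: S_def slab_def)
  show "(\<lambda>\<omega>. emeasure (\<pi> \<omega>) (S (snd (G h k \<omega>)))) \<in> borel_measurable M"
    unfolding ghist_def by (rule P.nn_integral_hist_region(1)[OF S])
  show "(\<integral>\<^sup>+\<omega>. emeasure (\<pi> \<omega>) (S (snd (G h k \<omega>))) \<partial>M)
      = (\<integral>\<^sup>+\<omega>. ennreal ((hi (snd (G h k \<omega>)) - lo (snd (G h k \<omega>))) * h) \<partial>M)"
    unfolding ghist_def P.nn_integral_hist_region(2)[OF S] em ..
qed

lemma lev_nonneg: "0 \<le> lev \<mu> h c"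
  using \<mu> \<alpha>_bounds \<beta> by (auto simp: lev_def intro!: add_nonneg_nonneg mult_nonneg_nonneg wt_nonneg)

text \<open>The mean mass of the box is h times the mean level, which is affine in the weighted
  history. That this mean is finite also makes the mass almost surely finite, so that count and mass
  agree.\<close>

lemma mean_gcount:
  assumes h: "0 < h" and int: "integrable M (\<lambda>\<omega>. wt \<beta> h (snd (G h k \<omega>)))"
  shows "integrable M (\<lambda>\<omega>. real (gcount \<mu> \<mu>' h (\<pi> \<omega>) (\<pi>' \<omega>) k))"
    and "(\<integral>\<omega>. real (gcount \<mu> \<mu>' h (\<pi> \<omega>) (\<pi>' \<omega>) k) \<partial>M)
      = h * (\<mu> + \<alpha> (real (Suc k) * h / T) * (\<integral>\<omega>. wt \<beta> h (snd (G h k \<omega>)) \<partial>M))"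
proof -
  note [measurable] = gcount_measurable[OF h]
  let ?c = "\<lambda>\<omega>. gcount \<mu> \<mu>' h (\<pi> \<omega>) (\<pi>' \<omega>) k"
  let ?e = "h * (\<mu> + \<alpha> (real (Suc k) * h / T) * (\<integral>\<omega>. wt \<beta> h (snd (G h k \<omega>)) \<partial>M))"
  have lev_eq: "lev \<mu> h (snd (G h k \<omega>)) = \<mu> + \<alpha> (real (Suc k) * h / T) * wt \<beta> h (snd (G h k \<omega>))" for \<omega>
    by (simp add: lev_def snd_ghist)
  have int_lev: "integrable M (\<lambda>\<omega>. lev \<mu> h (snd (G h k \<omega>)) * h)"
    unfolding lev_eq using int by simp
  have E1: "(\<integral>\<^sup>+\<omega>. ennreal (lev \<mu> h (snd (G h k \<omega>)) * h) \<partial>M) = ennreal (\<integral>\<omega>. lev \<mu> h (snd (G h k \<omega>)) * h \<partial>M)"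
    using lev_nonneg h by (intro nn_integral_eq_integral[OF int_lev] AE_I2) auto
  have E2: "(\<integral>\<omega>. lev \<mu> h (snd (G h k \<omega>)) * h \<partial>M) = ?e"
    unfolding lev_eq using int by (simp add: p.prob_space mult.commute)
  have E3: "(\<integral>\<^sup>+\<omega>. emeasure (\<pi> \<omega>) (gbox \<mu> \<mu>' h (\<pi> \<omega>) (\<pi>' \<omega>) k) \<partial>M)
      = (\<integral>\<^sup>+\<omega>. ennreal (lev \<mu> h (snd (G h k \<omega>)) * h) \<partial>M)"
    unfolding gbox_def box_def
    using mean_strip(2)[where lo="\<lambda>_. 0" and hi="lev \<mu> h", OF h lev_nonneg, of k]
    unfolding diff_zero .
  have E: "(\<integral>\<^sup>+\<omega>. emeasure (\<pi> \<omega>) (gbox \<mu> \<mu>' h (\<pi> \<omega>) (\<pi>' \<omega>) k) \<partial>M) = ennreal ?e"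
    unfolding E3 E1 E2 ..
  have [measurable]: "(\<lambda>\<omega>. emeasure (\<pi> \<omega>) (gbox \<mu> \<mu>' h (\<pi> \<omega>) (\<pi>' \<omega>) k)) \<in> borel_measurable M"
    unfolding gbox_def box_def
    by (rule mean_strip(1)[where lo="\<lambda>_. 0" and hi="lev \<mu> h", OF h lev_nonneg])
  have "AE \<omega> in M. emeasure (\<pi> \<omega>) (gbox \<mu> \<mu>' h (\<pi> \<omega>) (\<pi>' \<omega>) k) \<noteq> \<infinity>"
    by (rule nn_integral_PInf_AE) (auto simp: E)
  then have "AE \<omega> in M. emeasure (\<pi> \<omega>) (gbox \<mu> \<mu>' h (\<pi> \<omega>) (\<pi>' \<omega>) k) = ennreal (real (?c \<omega>))"
  proof (rule AE_mp, intro AE_I2 impI)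
    fix \<omega> assume \<omega>: "\<omega> \<in> space M" "emeasure (\<pi> \<omega>) (gbox \<mu> \<mu>' h (\<pi> \<omega>) (\<pi>' \<omega>) k) \<noteq> \<infinity>"
    have "gbox \<mu> \<mu>' h (\<pi> \<omega>) (\<pi>' \<omega>) k \<in> sets lborel"
      unfolding gbox_def box_def by (rule strip_sets)
    then show "emeasure (\<pi> \<omega>) (gbox \<mu> \<mu>' h (\<pi> \<omega>) (\<pi>' \<omega>) k) = ennreal (real (?c \<omega>))"
      unfolding gcount_def ennreal_of_nat_eq_real_of_nat[symmetric]
      using \<omega> by (intro emeasure_eq_num_points p.integer_valued) (auto simp: less_top)
  qed
  then have E': "(\<integral>\<^sup>+\<omega>. ennreal (real (?c \<omega>)) \<partial>M) = ennreal ?e"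
    unfolding E[symmetric] by (intro nn_integral_cong_AE) (auto elim: AE_mp)
  have e0: "0 \<le> ?e"
    using h \<mu> \<alpha>_bounds \<beta>
    by (intro mult_nonneg_nonneg add_nonneg_nonneg integral_nonneg_AE AE_I2 wt_nonneg) auto
  show "integrable M (\<lambda>\<omega>. real (?c \<omega>))"
    by (rule integrableI_nn_integral_finite[OF _ _ E']) auto
  show "(\<integral>\<omega>. real (?c \<omega>) \<partial>M) = ?e"
    using e0 by (subst integral_eq_nn_integral) (auto simp: E')
qed

text \<open>The graph of the limiting intensity is covered, for every \<open>\<epsilon>\<close>, by the \<open>liminf\<close> of the
  \<open>\<epsilon>\<close>-neighbourhoods of the graphs of the explicit scheme, whose mean number of points is \<open>2 \<epsilon> \<tau>\<close>.\<close>
lemma AE_no_boundary_points: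
  fixes h :: "nat \<Rightarrow> real"
  assumes h: "\<And>n. 0 < h n" "\<And>n. real (Suc n) * h n = \<tau>" "0 < \<tau>"
  shows "AE \<omega> in M. AE (x, s) in \<pi> \<omega>. \<not> (0 < s \<and> s \<le> \<tau> \<and>
    (\<lambda>n. glevel \<mu> \<mu>' (h n) (\<pi> \<omega>) (\<pi>' \<omega>) (slab_index (h n) s)) \<longlonglongrightarrow> x)"
proof -
  define \<epsilon> where "\<epsilon> i = 1 / real (Suc i)" for i
  have \<epsilon>: "0 < \<epsilon> i" for i by (simp add: \<epsilon>_def)
  define S where "S i n c = {lev \<mu> (h n) c - \<epsilon> i..lev \<mu> (h n) c + \<epsilon> i} \<times>
      {real (length c) * h n<..real (Suc (length c)) * h n}" for i n c
  define W where "W i n \<omega> = (\<Sum>k<Suc n. emeasure (\<pi> \<omega>) (S i n (snd (G (h n) k \<omega>))))" for i n \<omega>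
  have meas [measurable]: "(\<lambda>\<omega>. emeasure (\<pi> \<omega>) (S i n (snd (G (h n) k \<omega>)))) \<in> borel_measurable M" for i n k
    unfolding S_def using \<epsilon>[of i] by (intro mean_strip(1) h(1)) simp
  have W [measurable]: "W i n \<in> borel_measurable M" for i n
    unfolding W_def by measurable
  have "(\<integral>\<^sup>+\<omega>. W i n \<omega> \<partial>M) = ennreal (2 * \<epsilon> i * \<tau>)" for i n
  proof -
    have "(\<integral>\<^sup>+\<omega>. W i n \<omega> \<partial>M) = (\<Sum>k<Suc n. \<integral>\<^sup>+\<omega>. emeasure (\<pi> \<omega>) (S i n (snd (G (h n) k \<omega>))) \<partial>M)"
      unfolding W_def by (rule nn_integral_sum) simp
    also have "\<dots> = (\<Sum>k<Suc n. ennreal (2 * \<epsilon> i * h n))"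
    proof (intro sum.cong refl)
      fix k
      have "(\<integral>\<^sup>+\<omega>. emeasure (\<pi> \<omega>) (S i n (snd (G (h n) k \<omega>))) \<partial>M)
          = (\<integral>\<^sup>+\<omega>. ennreal ((lev \<mu> (h n) (snd (G (h n) k \<omega>)) + \<epsilon> i - (lev \<mu> (h n) (snd (G (h n) k \<omega>)) - \<epsilon> i)) * h n) \<partial>M)"
        unfolding S_def using \<epsilon>[of i] by (intro mean_strip(2) h(1)) simp
      also have "\<dots> = (\<integral>\<^sup>+\<omega>. ennreal (2 * \<epsilon> i * h n) \<partial>M)" by simp
      finally show "(\<integral>\<^sup>+\<omega>. emeasure (\<pi> \<omega>) (S i n (snd (G (h n) k \<omega>))) \<partial>M) = ennreal (2 * \<epsilon> i * h n)"
        by (simp add: p.emeasure_space_1)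
    qed
    also have "\<dots> = ennreal (\<Sum>k<Suc n. 2 * \<epsilon> i * h n)"
      using \<epsilon>[of i] h(1)[of n] by (intro sum_ennreal) simp
    also have "(\<Sum>k<Suc n. 2 * \<epsilon> i * h n) = 2 * \<epsilon> i * (real (Suc n) * h n)" by (simp add: algebra_simps)
    finally show ?thesis unfolding h(2) .
  qed
  \<comment> \<open>Fatou on the probability space; the infimum over i then brings the bound down to
    0.\<close>
  then have "(\<integral>\<^sup>+\<omega>. liminf (\<lambda>n. W i n \<omega>) \<partial>M) \<le> ennreal (2 * \<epsilon> i * \<tau>)" for i
    using nn_integral_liminf[of "W i" M, OF W] by (simp add: Liminf_const)
  then have le: "(\<integral>\<^sup>+\<omega>. (INF i. liminf (\<lambda>n. W i n \<omega>)) \<partial>M) \<le> ennreal (2 * \<epsilon> i * \<tau>)" for i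
    by (rule order_trans[OF nn_integral_mono[OF INF_lower[OF UNIV_I]]])
  have "(\<lambda>i. ennreal (2 * \<epsilon> i * \<tau>)) \<longlonglongrightarrow> ennreal 0"
    unfolding \<epsilon>_def by (intro tendsto_ennrealI) real_asymp
  then have "(\<integral>\<^sup>+\<omega>. (INF i. liminf (\<lambda>n. W i n \<omega>)) \<partial>M) \<le> ennreal 0"
    by (rule LIMSEQ_le_const) (use le in auto)
  then have "(\<integral>\<^sup>+\<omega>. (INF i. liminf (\<lambda>n. W i n \<omega>)) \<partial>M) = 0" by simp
  then have "AE \<omega> in M. (INF i. liminf (\<lambda>n. W i n \<omega>)) = 0"
    by (subst (asm) nn_integral_0_iff_AE) auto
  with AE_space show ?thesis
  proof eventually_elim
    case \<omega>: (elim \<omega>)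
    define U where "U i n = (\<Union>k<Suc n. S i n (snd (G (h n) k \<omega>)))" for i n
    have sets_\<pi>: "sets (\<pi> \<omega>) = sets lborel" using p.sets_eq[OF \<omega>(1)] .
    have S_sets: "S i n c \<in> sets (\<pi> \<omega>)" for i n c
      unfolding S_def sets_\<pi> by (rule strip_sets)
    then have U_sets [measurable]: "U i n \<in> sets (\<pi> \<omega>)" for i n
      unfolding U_def by (intro sets.finite_UN) auto
    \<comment> \<open>A measurable function that is at least 1 at every boundary point stands in for
      the indicator of these points. A second application of Fatou, now for the measure
      \<open>\<pi> \<omega>\<close>, bounds its integral.\<close>
    define f where "f z = (INF i. liminf (\<lambda>n. indicator (U i n) z :: ennreal))" for z
    have f_meas: "f \<in> borel_measurable (\<pi> \<omega>)" unfolding f_def by measurable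
    have "(\<integral>\<^sup>+z. f z \<partial>\<pi> \<omega>) \<le> liminf (\<lambda>n. W i n \<omega>)" for i
    proof -
      have "(\<integral>\<^sup>+z. f z \<partial>\<pi> \<omega>) \<le> (\<integral>\<^sup>+z. liminf (\<lambda>n. indicator (U i n) z) \<partial>\<pi> \<omega>)"
        unfolding f_def by (intro nn_integral_mono INF_lower) simp
      also have "\<dots> \<le> liminf (\<lambda>n. \<integral>\<^sup>+z. indicator (U i n) z \<partial>\<pi> \<omega>)"
        by (intro nn_integral_liminf) measurable
      also have "\<dots> \<le> liminf (\<lambda>n. W i n \<omega>)"
      proof (intro Liminf_mono always_eventually allI)
        fix n
        show "(\<integral>\<^sup>+z. indicator (U i n) z \<partial>\<pi> \<omega>) \<le> W i n \<omega>"
          unfolding W_def nn_integral_indicator[OF U_sets]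
          unfolding U_def using S_sets by (intro emeasure_subadditive_finite) auto
      qed
      finally show ?thesis .
    qed
    then have "(\<integral>\<^sup>+z. f z \<partial>\<pi> \<omega>) \<le> (INF i. liminf (\<lambda>n. W i n \<omega>))" by (intro INF_greatest)
    then have "AE z in \<pi> \<omega>. f z = 0"
      using \<omega>(2) nn_integral_0_iff_AE[OF f_meas] by simp
    then show "AE (x, s) in \<pi> \<omega>. \<not> (0 < s \<and> s \<le> \<tau> \<and>
      (\<lambda>n. glevel \<mu> \<mu>' (h n) (\<pi> \<omega>) (\<pi>' \<omega>) (slab_index (h n) s)) \<longlonglongrightarrow> x)"
    proof (rule AE_mp, intro AE_I2 impI)
      fix z assume fz: "f z = 0"
      obtain x s where z: "z = (x, s)" by (cases z)
      { assume "0 < s \<and> s \<le> \<tau> \<and> (\<lambda>n. glevel \<mu> \<mu>' (h n) (\<pi> \<omega>) (\<pi>' \<omega>) (slab_index (h n) s)) \<longlonglongrightarrow> x"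
      with fz have f: "f (x, s) = 0" and s: "0 < s" "s \<le> \<tau>"
        and lim: "(\<lambda>n. glevel \<mu> \<mu>' (h n) (\<pi> \<omega>) (\<pi>' \<omega>) (slab_index (h n) s)) \<longlonglongrightarrow> x"
        by (auto simp: z)
      have "1 \<le> liminf (\<lambda>n. indicator (U i n) (x, s) :: ennreal)" for i
      proof (rule Liminf_bounded)
        have "\<forall>\<^sub>F n in sequentially. dist (glevel \<mu> \<mu>' (h n) (\<pi> \<omega>) (\<pi>' \<omega>) (slab_index (h n) s)) x < \<epsilon> i"
          using lim \<epsilon> by (rule tendstoD)
        then show "\<forall>\<^sub>F n in sequentially. 1 \<le> (indicator (U i n) (x, s) :: ennreal)"
        proof eventually_elim
          case (elim n)
          have "slab_index (h n) s < Suc n" using s h by (intro slab_index_less) auto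
          moreover have "(x, s) \<in> S i n (snd (G (h n) (slab_index (h n) s) \<omega>))"
            using elim slab_index_bounds[OF h(1) s(1), of n]
            by (auto simp: S_def glevel_def dist_real_def snd_ghist)
          ultimately show ?case by (auto simp: U_def indicator_def)
        qed
      qed
      then have "1 \<le> f (x, s)" unfolding f_def by (intro INF_greatest)
      then have False using f by simp }
      then show "case z of (x, s) \<Rightarrow> \<not> (0 < s \<and> s \<le> \<tau> \<and>
          (\<lambda>n. glevel \<mu> \<mu>' (h n) (\<pi> \<omega>) (\<pi>' \<omega>) (slab_index (h n) s)) \<longlonglongrightarrow> x)"
        by (auto simp: z)
    qed
  qed
qed

end

section \<open>From the mean recursion to the mean of the process\<close>

context hawkes_prms
begin

text \<open>One induction for both coordinates: the next count of either process is integrable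
  because the weighted history of the other is.\<close>

lemma wt_integrable:
  assumes h: "0 < h"
  shows "integrable M (\<lambda>\<omega>. wt \<beta> h (snd (G h k \<omega>))) \<and> integrable M (\<lambda>\<omega>. wt \<beta> h (fst (G h k \<omega>)))"
proof (induction k)
  case 0
  then show ?case by (simp add: ghist_def)
next
  case (Suc k)
  interpret S: hawkes_prms \<alpha> \<beta> T M \<pi>' \<pi> \<mu>' \<mu> by (rule hawkes_prms_swap)
  have "integrable M (\<lambda>\<omega>. wt \<beta> h (snd (S.G h k \<omega>)))"
    using Suc by (simp add: ghist_swap[of \<mu>' \<mu>])
  then show ?case
    using Suc mean_gcount(1)[OF h, of k] S.mean_gcount(1)[OF h, of k]
    by (simp add: snd_ghist fst_ghist wt_snoc)
qed

lemma wt_mean_Suc: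
  assumes h: "0 < h"
  shows "(\<integral>\<omega>. wt \<beta> h (fst (G h (Suc k) \<omega>)) \<partial>M) = exp (- (\<beta> * h)) * ((\<integral>\<omega>. wt \<beta> h (fst (G h k \<omega>)) \<partial>M) +
    \<beta> * (exp (- (\<beta> * h)) * (h * (\<mu> + \<alpha> (real (Suc k) * h / T) * (\<integral>\<omega>. wt \<beta> h (snd (G h k \<omega>)) \<partial>M)))))"
proof -
  note int = wt_integrable[OF h, of k, THEN conjunct1] wt_integrable[OF h, of k, THEN conjunct2]
  have "(\<integral>\<omega>. wt \<beta> h (fst (G h (Suc k) \<omega>)) \<partial>M)
      = (\<integral>\<omega>. exp (- (\<beta> * h)) * (wt \<beta> h (fst (G h k \<omega>)) +
          \<beta> * (exp (- (\<beta> * h)) * real (gcount \<mu> \<mu>' h (\<pi> \<omega>) (\<pi>' \<omega>) k))) \<partial>M)"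
    by (simp add: fst_ghist wt_snoc)
  also have "\<dots> = exp (- (\<beta> * h)) * ((\<integral>\<omega>. wt \<beta> h (fst (G h k \<omega>)) \<partial>M) +
          \<beta> * (exp (- (\<beta> * h)) * (\<integral>\<omega>. real (gcount \<mu> \<mu>' h (\<pi> \<omega>) (\<pi>' \<omega>) k) \<partial>M)))"
    using int(2) mean_gcount(1)[OF h int(1)] by simp
  finally show ?thesis unfolding mean_gcount(2)[OF h int(1)] .
qed

text \<open>The coupled recursions for the two means decouple in their sum and their difference. The
  sum gives a bound uniform in the mesh, the difference is an instance of
  \<open>discrete_difference\<close>.\<close>

lemma mean_sum_gcount:
  assumes h: "0 < h"
  defines "e \<equiv> \<lambda>k. \<integral>\<omega>. real (gcount \<mu> \<mu>' h (\<pi> \<omega>) (\<pi>' \<omega>) k) \<partial>M"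
    and "e' \<equiv> \<lambda>k. \<integral>\<omega>. real (gcount \<mu>' \<mu> h (\<pi>' \<omega>) (\<pi> \<omega>) k) \<partial>M"
  shows "(\<Sum>k<n. e k + e' k) \<le> (real n * h) * ((\<mu> + \<mu>') + \<beta> * (\<mu> + \<mu>') * (real n * h))"
    and "\<lbrakk> \<mu>' \<le> \<mu>; real n * h \<le> T; \<And>x. g x = \<alpha> x / (1 + \<alpha> x);
      \<And>x x'. 0 \<le> x \<Longrightarrow> x \<le> x' \<Longrightarrow> x' \<le> 1 \<Longrightarrow> \<bar>g x - g x'\<bar> \<le> 2 * (x' - x);
      F 0 = 0; \<And>x. x \<in> {0..1} \<Longrightarrow> (F has_real_derivative 1 / (1 + \<alpha> x)) (at x) \<rbrakk> \<Longrightarrow>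
      \<bar>(\<Sum>k<n. e k - e' k) - T * (\<mu> - \<mu>') * F (real n * h / T)\<bar>
        \<le> 3 * (\<mu> - \<mu>') / \<beta> + (3 * \<beta> * T + 2) * (\<mu> - \<mu>') * h"
proof -
  interpret S: hawkes_prms \<alpha> \<beta> T M \<pi>' \<pi> \<mu>' \<mu> by (rule hawkes_prms_swap)
  define a where "a k = \<alpha> (real (Suc k) * h / T)" for k
  define Y where "Y k = (\<integral>\<omega>. wt \<beta> h (snd (G h k \<omega>)) \<partial>M)" for k
  define Y' where "Y' k = (\<integral>\<omega>. wt \<beta> h (fst (G h k \<omega>)) \<partial>M)" for k
  have SG: "S.G h k \<omega> = prod.swap (G h k \<omega>)" for k \<omega> by (rule ghist_swap)
  have e: "e k = h * (\<mu> + a k * Y k)" and e': "e' k = h * (\<mu>' + a k * Y' k)" for k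
    using mean_gcount(2)[OF h, of k] S.mean_gcount(2)[OF h, of k] wt_integrable[OF h, of k]
    by (simp_all add: e_def e'_def a_def Y_def Y'_def SG)
  have Suc': "Y' (Suc k) = exp (- (\<beta> * h)) * (Y' k + \<beta> * (exp (- (\<beta> * h)) * (h * (\<mu> + a k * Y k))))" for k
    using wt_mean_Suc[OF h, of k] by (simp add: a_def Y_def Y'_def)
  have Suc: "Y (Suc k) = exp (- (\<beta> * h)) * (Y k + \<beta> * (exp (- (\<beta> * h)) * (h * (\<mu>' + a k * Y' k))))" for k
    using S.wt_mean_Suc[OF h, of k] by (simp add: a_def Y_def Y'_def SG)
  have zero: "Y 0 = 0" "Y' 0 = 0" by (simp_all add: Y_def Y'_def ghist_def)
  have "(\<Sum>k<n. e k + e' k) = (\<Sum>k<n. h * ((\<mu> + \<mu>') + a k * (Y k + Y' k)))"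
    by (simp add: e e' algebra_simps)
  also have "\<dots> \<le> (real n * h) * ((\<mu> + \<mu>') + \<beta> * (\<mu> + \<mu>') * (real n * h))"
    by (rule discrete_sum_bound[OF h \<beta>])
       (use \<mu> \<alpha>_bounds in \<open>auto simp: a_def zero\<close>, simp add: Suc Suc' a_def algebra_simps)
  finally show "(\<Sum>k<n. e k + e' k) \<le> (real n * h) * ((\<mu> + \<mu>') + \<beta> * (\<mu> + \<mu>') * (real n * h))" .
  assume *: "\<mu>' \<le> \<mu>" "real n * h \<le> T" "\<And>x. g x = \<alpha> x / (1 + \<alpha> x)"
    "\<And>x x'. 0 \<le> x \<Longrightarrow> x \<le> x' \<Longrightarrow> x' \<le> 1 \<Longrightarrow> \<bar>g x - g x'\<bar> \<le> 2 * (x' - x)"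
    "F 0 = 0" "\<And>x. x \<in> {0..1} \<Longrightarrow> (F has_real_derivative 1 / (1 + \<alpha> x)) (at x)"
  interpret D: discrete_difference h \<beta> "\<mu> - \<mu>'" a "\<lambda>k. Y' k - Y k" "exp (- (\<beta> * h))"
    by unfold_locales (use h \<beta> *(1) \<alpha>_bounds in \<open>auto simp: a_def zero\<close>, simp add: Suc Suc' a_def algebra_simps)
  have "(\<Sum>k<n. e k - e' k) = (\<Sum>k<n. h * ((\<mu> - \<mu>') - a k * (Y' k - Y k)))"
    by (simp add: e e' algebra_simps)
  then show "\<bar>(\<Sum>k<n. e k - e' k) - T * (\<mu> - \<mu>') * F (real n * h / T)\<bar>
        \<le> 3 * (\<mu> - \<mu>') / \<beta> + (3 * \<beta> * T + 2) * (\<mu> - \<mu>') * h"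
    using D.sum_difference_approx[OF T *(2) _ _ *(3) *(4) *(5) *(6)] \<alpha>_bounds by (simp add: a_def)
qed

lemma AE_grid_limit:
  fixes N N' :: "real \<Rightarrow> 'a \<Rightarrow> nat"
  assumes \<tau>: "0 < \<tau>" "\<tau> \<le> T"
    and thin: "AE \<omega> in M. \<forall>t\<in>{0..T}.
      of_nat (N t \<omega>) = emeasure (\<pi> \<omega>) (thinning_region (intensity \<mu> \<alpha> \<beta> T (\<lambda>s. N' s \<omega>)) t) \<and>
      of_nat (N' t \<omega>) = emeasure (\<pi>' \<omega>) (thinning_region (intensity \<mu>' \<alpha> \<beta> T (\<lambda>s. N s \<omega>)) t)"
  shows "AE \<omega> in M. grid_limit \<alpha> \<beta> T (\<pi> \<omega>) (\<pi>' \<omega>) \<mu> \<mu>' (\<lambda>t. N t \<omega>) (\<lambda>t. N' t \<omega>) \<tau>"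
proof -
  interpret S: hawkes_prms \<alpha> \<beta> T M \<pi>' \<pi> \<mu>' \<mu> by (rule hawkes_prms_swap)
  define h where "h n = \<tau> / real (Suc n)" for n
  have h: "0 < h n" "real (Suc n) * h n = \<tau>" for n using \<tau> by (auto simp: h_def)
  show ?thesis
    using AE_space thin AE_no_boundary_points[OF h \<tau>(1)] S.AE_no_boundary_points[OF h \<tau>(1)]
  proof eventually_elim
    case (elim \<omega>)
    have "coupled_paths \<alpha> \<beta> T (\<pi> \<omega>) (\<pi>' \<omega>) \<mu> \<mu>' (\<lambda>t. N t \<omega>) (\<lambda>t. N' t \<omega>)"
    proof
      show "sets (\<pi> \<omega>) = sets borel" "sets (\<pi>' \<omega>) = sets borel"
        using p.sets_eq[OF elim(1)] p'.sets_eq[OF elim(1)] by simp_all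
      show "emeasure (\<pi> \<omega>) A \<in> range ennreal_of_enat" "emeasure (\<pi>' \<omega>) A \<in> range ennreal_of_enat"
        if "A \<in> sets borel" for A
        using that p.integer_valued[OF elim(1)] p'.integer_valued[OF elim(1)] by simp_all
    qed (use elim(2) in auto)
    then show ?case
      using \<tau> elim(3,4) unfolding h_def by (simp add: grid_limit_def grid_limit_axioms_def)
  qed
qed

text \<open>The majorant of the scheme is \<open>N \<tau>\<close> itself, whose integrability has to
  be earned first: Fatou transfers the mesh-independent bound \<open>K\<close> to the limit.
  Dominated convergence then gives the mean.\<close>

lemma mean_count_limit:
  fixes N N' :: "real \<Rightarrow> 'a \<Rightarrow> nat"
  assumes \<tau>: "0 < \<tau>" "\<tau> \<le> T"
    and meas [measurable]: "N \<tau> \<in> measurable M (count_space UNIV)"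
    and lim: "AE \<omega> in M. grid_limit \<alpha> \<beta> T (\<pi> \<omega>) (\<pi>' \<omega>) \<mu> \<mu>' (\<lambda>t. N t \<omega>) (\<lambda>t. N' t \<omega>) \<tau>"
  defines "h \<equiv> \<lambda>n. \<tau> / real (Suc n)"
  shows "integrable M (\<lambda>\<omega>. real (N \<tau> \<omega>))"
    and "(\<lambda>n. \<Sum>k<Suc n. \<integral>\<omega>. real (gcount \<mu> \<mu>' (h n) (\<pi> \<omega>) (\<pi>' \<omega>) k) \<partial>M) \<longlonglongrightarrow> (\<integral>\<omega>. real (N \<tau> \<omega>) \<partial>M)"
proof -
  interpret S: hawkes_prms \<alpha> \<beta> T M \<pi>' \<pi> \<mu>' \<mu> by (rule hawkes_prms_swap)
  have h: "0 < h n" "real (Suc n) * h n = \<tau>" for n using \<tau> by (auto simp: h_def)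
  define c where "c n k \<omega> = real (gcount \<mu> \<mu>' (h n) (\<pi> \<omega>) (\<pi>' \<omega>) k)" for n k \<omega>
  define Z where "Z n \<omega> = (\<Sum>k<Suc n. c n k \<omega>)" for n \<omega>
  have c_int: "integrable M (c n k)" for n k
    unfolding c_def using mean_gcount(1)[OF h(1)] wt_integrable[OF h(1)] by blast
  have Z_int: "integrable M (Z n)" for n
    unfolding Z_def by (intro Bochner_Integration.integrable_sum c_int)
  have Z_mean: "(\<integral>\<omega>. Z n \<omega> \<partial>M) = (\<Sum>k<Suc n. \<integral>\<omega>. c n k \<omega> \<partial>M)" for n
    unfolding Z_def by (intro Bochner_Integration.integral_sum c_int)
  have Z_nonneg: "0 \<le> Z n \<omega>" for n \<omega>
    unfolding Z_def c_def by (intro sum_nonneg) simp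
  have Z_lim: "AE \<omega> in M. (\<lambda>n. Z n \<omega>) \<longlonglongrightarrow> real (N \<tau> \<omega>)"
    using lim
  proof eventually_elim
    case (elim \<omega>)
    interpret L: grid_limit \<alpha> \<beta> T "\<pi> \<omega>" "\<pi>' \<omega>" \<mu> \<mu>' "\<lambda>t. N t \<omega>" "\<lambda>t. N' t \<omega>" \<tau> h
      unfolding h_def by (rule elim)
    have "\<forall>\<^sub>F n in sequentially. Z n \<omega> = real (N \<tau> \<omega>)"
      using L.sum_gcount_eventually_eq by eventually_elim (simp only: Z_def c_def flip: of_nat_sum)
    then show ?case by (rule tendsto_eventually)
  qed
  have Z_le: "AE \<omega> in M. norm (Z n \<omega>) \<le> real (N \<tau> \<omega>)" for n
    using lim
  proof eventually_elim
    case (elim \<omega>)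
    interpret L: grid_limit \<alpha> \<beta> T "\<pi> \<omega>" "\<pi>' \<omega>" \<mu> \<mu>' "\<lambda>t. N t \<omega>" "\<lambda>t. N' t \<omega>" \<tau> h
      unfolding h_def by (rule elim)
    have "(\<Sum>k<Suc n. gcount \<mu> \<mu>' (h n) (\<pi> \<omega>) (\<pi>' \<omega>) k) \<le> N (real (Suc n) * h n) \<omega>"
      using \<tau> h(2)[of n] by (intro L.sum_gcount_le h(1)) simp
    moreover have "Z n \<omega> = real (\<Sum>k<Suc n. gcount \<mu> \<mu>' (h n) (\<pi> \<omega>) (\<pi>' \<omega>) k)"
      unfolding Z_def c_def of_nat_sum ..
    ultimately show ?case unfolding h(2) by (simp del: sum.lessThan_Suc of_nat_sum)
  qed
  define K where "K = \<tau> * ((\<mu> + \<mu>') + \<beta> * (\<mu> + \<mu>') * \<tau>)"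
  have "(\<integral>\<omega>. Z n \<omega> \<partial>M) \<le> K" for n
  proof -
    have "(\<integral>\<omega>. Z n \<omega> \<partial>M)
        \<le> (\<Sum>k<Suc n. (\<integral>\<omega>. c n k \<omega> \<partial>M) + (\<integral>\<omega>. real (gcount \<mu>' \<mu> (h n) (\<pi>' \<omega>) (\<pi> \<omega>) k) \<partial>M))"
      unfolding Z_mean by (intro sum_mono) simp
    also have "\<dots> \<le> K"
      unfolding K_def c_def using mean_sum_gcount(1)[OF h(1)[of n], of "Suc n"] unfolding h(2) .
    finally show ?thesis .
  qed
  then have "(\<integral>\<^sup>+\<omega>. ennreal (Z n \<omega>) \<partial>M) \<le> ennreal K" for n
    using Z_nonneg by (subst nn_integral_eq_integral[OF Z_int]) (auto intro!: ennreal_leI)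
  then have "liminf (\<lambda>n. \<integral>\<^sup>+\<omega>. ennreal (Z n \<omega>) \<partial>M) \<le> liminf (\<lambda>_::nat. ennreal K)"
    by (intro Liminf_mono always_eventually allI)
  then have "liminf (\<lambda>n. \<integral>\<^sup>+\<omega>. ennreal (Z n \<omega>) \<partial>M) \<le> ennreal K"
    by (simp only: Liminf_const trivial_limit_sequentially not_False_eq_True)
  moreover have "(\<integral>\<^sup>+\<omega>. liminf (\<lambda>n. ennreal (Z n \<omega>)) \<partial>M) \<le> liminf (\<lambda>n. \<integral>\<^sup>+\<omega>. ennreal (Z n \<omega>) \<partial>M)"
    using borel_measurable_integrable[OF Z_int] by (intro nn_integral_liminf) simp
  moreover have "(\<integral>\<^sup>+\<omega>. liminf (\<lambda>n. ennreal (Z n \<omega>)) \<partial>M) = (\<integral>\<^sup>+\<omega>. ennreal (real (N \<tau> \<omega>)) \<partial>M)"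
  proof (rule nn_integral_cong_AE)
    show "AE \<omega> in M. liminf (\<lambda>n. ennreal (Z n \<omega>)) = ennreal (real (N \<tau> \<omega>))"
      using Z_lim
    proof eventually_elim
      case (elim \<omega>)
      then show ?case by (intro lim_imp_Liminf tendsto_ennrealI) auto
    qed
  qed
  ultimately have "(\<integral>\<^sup>+\<omega>. ennreal (real (N \<tau> \<omega>)) \<partial>M) < \<infinity>"
    by (metis ennreal_less_top infinity_ennreal_def order_le_less_trans)
  then show N_int: "integrable M (\<lambda>\<omega>. real (N \<tau> \<omega>))"
    by (intro integrableI_nonneg) auto
  have "(\<lambda>n. \<integral>\<omega>. Z n \<omega> \<partial>M) \<longlonglongrightarrow> (\<integral>\<omega>. real (N \<tau> \<omega>) \<partial>M)"
    using borel_measurable_integrable[OF Z_int] Z_lim Z_le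
    by (intro integral_dominated_convergence[OF _ _ N_int]) auto
  then show "(\<lambda>n. \<Sum>k<Suc n. \<integral>\<omega>. real (gcount \<mu> \<mu>' (h n) (\<pi> \<omega>) (\<pi>' \<omega>) k) \<partial>M) \<longlonglongrightarrow> (\<integral>\<omega>. real (N \<tau> \<omega>) \<partial>M)"
    unfolding Z_mean c_def .
qed

text \<open>As the mesh vanishes, only the part of the discretisation error that is independent of h
  survives.\<close>

lemma mean_difference_bound:
  fixes N N' :: "real \<Rightarrow> 'a \<Rightarrow> nat" and g F :: "real \<Rightarrow> real"
  assumes \<tau>: "0 < \<tau>" "\<tau> \<le> T"
    and meas: "N \<tau> \<in> measurable M (count_space UNIV)" "N' \<tau> \<in> measurable M (count_space UNIV)"
    and thin: "AE \<omega> in M. \<forall>t\<in>{0..T}.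
      of_nat (N t \<omega>) = emeasure (\<pi> \<omega>) (thinning_region (intensity \<mu> \<alpha> \<beta> T (\<lambda>s. N' s \<omega>)) t) \<and>
      of_nat (N' t \<omega>) = emeasure (\<pi>' \<omega>) (thinning_region (intensity \<mu>' \<alpha> \<beta> T (\<lambda>s. N s \<omega>)) t)"
    and le: "\<mu>' \<le> \<mu>"
    and g: "\<And>x. g x = \<alpha> x / (1 + \<alpha> x)"
    and lip: "\<And>x x'. 0 \<le> x \<Longrightarrow> x \<le> x' \<Longrightarrow> x' \<le> 1 \<Longrightarrow> \<bar>g x - g x'\<bar> \<le> 2 * (x' - x)"
    and F: "F 0 = 0" "\<And>x. x \<in> {0..1} \<Longrightarrow> (F has_real_derivative 1 / (1 + \<alpha> x)) (at x)"
  shows "integrable M (\<lambda>\<omega>. real (N \<tau> \<omega>))" "integrable M (\<lambda>\<omega>. real (N' \<tau> \<omega>))"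
    and "\<bar>(\<integral>\<omega>. real (N \<tau> \<omega>) \<partial>M) - (\<integral>\<omega>. real (N' \<tau> \<omega>) \<partial>M) - T * (\<mu> - \<mu>') * F (\<tau> / T)\<bar> \<le> 3 * (\<mu> - \<mu>') / \<beta>"
proof -
  interpret S: hawkes_prms \<alpha> \<beta> T M \<pi>' \<pi> \<mu>' \<mu> by (rule hawkes_prms_swap)
  have lim: "AE \<omega> in M. grid_limit \<alpha> \<beta> T (\<pi> \<omega>) (\<pi>' \<omega>) \<mu> \<mu>' (\<lambda>t. N t \<omega>) (\<lambda>t. N' t \<omega>) \<tau>"
    by (rule AE_grid_limit[OF \<tau> thin])
  have lim': "AE \<omega> in M. grid_limit \<alpha> \<beta> T (\<pi>' \<omega>) (\<pi> \<omega>) \<mu>' \<mu> (\<lambda>t. N' t \<omega>) (\<lambda>t. N t \<omega>) \<tau>"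
    using lim by eventually_elim (rule grid_limit.grid_limit_swap)
  note L = mean_count_limit[OF \<tau> meas(1) lim]
  note L' = S.mean_count_limit[OF \<tau> meas(2) lim']
  show "integrable M (\<lambda>\<omega>. real (N \<tau> \<omega>))" "integrable M (\<lambda>\<omega>. real (N' \<tau> \<omega>))" by (fact L(1) L'(1))+
  define h where "h n = \<tau> / real (Suc n)" for n
  have h: "0 < h n" "real (Suc n) * h n = \<tau>" for n using \<tau> by (auto simp: h_def)
  define D where "D n = (\<Sum>k<Suc n. (\<integral>\<omega>. real (gcount \<mu> \<mu>' (h n) (\<pi> \<omega>) (\<pi>' \<omega>) k) \<partial>M) -
      (\<integral>\<omega>. real (gcount \<mu>' \<mu> (h n) (\<pi>' \<omega>) (\<pi> \<omega>) k) \<partial>M))" for n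
  have "D \<longlonglongrightarrow> (\<integral>\<omega>. real (N \<tau> \<omega>) \<partial>M) - (\<integral>\<omega>. real (N' \<tau> \<omega>) \<partial>M)"
    unfolding D_def sum_subtractf h_def by (rule tendsto_diff[OF L(2) L'(2)])
  then have 1: "(\<lambda>n. \<bar>D n - T * (\<mu> - \<mu>') * F (\<tau> / T)\<bar>) \<longlonglongrightarrow>
      \<bar>(\<integral>\<omega>. real (N \<tau> \<omega>) \<partial>M) - (\<integral>\<omega>. real (N' \<tau> \<omega>) \<partial>M) - T * (\<mu> - \<mu>') * F (\<tau> / T)\<bar>"
    by (intro tendsto_intros)
  have "h \<longlonglongrightarrow> 0" unfolding h_def by real_asymp
  then have 2: "(\<lambda>n. 3 * (\<mu> - \<mu>') / \<beta> + (3 * \<beta> * T + 2) * (\<mu> - \<mu>') * h n) \<longlonglongrightarrow>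
      3 * (\<mu> - \<mu>') / \<beta> + (3 * \<beta> * T + 2) * (\<mu> - \<mu>') * 0"
    by (intro tendsto_intros)
  have "\<bar>D n - T * (\<mu> - \<mu>') * F (\<tau> / T)\<bar> \<le> 3 * (\<mu> - \<mu>') / \<beta> + (3 * \<beta> * T + 2) * (\<mu> - \<mu>') * h n" for n
    using mean_sum_gcount(2)[OF h(1)[of n] le _ g lip F, of "Suc n"] \<tau>(2) unfolding h(2) D_def by simp
  then show "\<bar>(\<integral>\<omega>. real (N \<tau> \<omega>) \<partial>M) - (\<integral>\<omega>. real (N' \<tau> \<omega>) \<partial>M) - T * (\<mu> - \<mu>') * F (\<tau> / T)\<bar>
      \<le> 3 * (\<mu> - \<mu>') / \<beta>"
    using LIMSEQ_le[OF 1 2] by simp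
qed

end

section \<open>The price process\<close>

text \<open>The artanh comes from the factorisation 1 + alpha_0 (1 - eta x^2) = (1 + alpha_0) (1 -
  zeta x^2). For zeta = 0 the quotient would read 0 / 0, so the linear primitive has its own
  branch.\<close>

definition drift_primitive :: "real \<Rightarrow> real \<Rightarrow> real \<Rightarrow> real" where
  "drift_primitive \<alpha>\<^sub>0 \<eta> x = (let \<zeta> = \<alpha>\<^sub>0 * \<eta> / (1 + \<alpha>\<^sub>0)
     in if \<zeta> = 0 then x / (1 + \<alpha>\<^sub>0) else artanh (sqrt \<zeta> * x) / (sqrt \<zeta> * (1 + \<alpha>\<^sub>0)))"

lemma drift_primitive_deriv:
  assumes \<alpha>\<^sub>0: "0 \<le> \<alpha>\<^sub>0" and \<eta>: "\<eta> \<in> {0..1}" and x: "x \<in> {0..1}"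
  shows "(drift_primitive \<alpha>\<^sub>0 \<eta> has_real_derivative 1 / (1 + \<alpha>\<^sub>0 * (1 - \<eta> * x\<^sup>2))) (at x)"
proof -
  define \<zeta> where "\<zeta> = \<alpha>\<^sub>0 * \<eta> / (1 + \<alpha>\<^sub>0)"
  have den: "1 + \<alpha>\<^sub>0 * (1 - \<eta> * x\<^sup>2) = (1 + \<alpha>\<^sub>0) * (1 - \<zeta> * x\<^sup>2)"
    using \<alpha>\<^sub>0 by (simp add: \<zeta>_def field_simps)
  show ?thesis
  proof (cases "\<zeta> = 0")
    case True
    then have "drift_primitive \<alpha>\<^sub>0 \<eta> = (\<lambda>x. x / (1 + \<alpha>\<^sub>0))"
      by (simp add: drift_primitive_def fun_eq_iff flip: \<zeta>_def)
    then show ?thesis unfolding den using True \<alpha>\<^sub>0 by (auto intro!: derivative_eq_intros)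
  next
    case False
    \<comment> \<open>zeta < 1 keeps the argument of artanh below 1 up to and including x =
      1.\<close>
    have \<zeta>: "0 < \<zeta>" "\<zeta> < 1"
    proof -
      have "0 \<le> \<zeta>" using \<alpha>\<^sub>0 \<eta> by (simp add: \<zeta>_def)
      with False show "0 < \<zeta>" by simp
      have "\<alpha>\<^sub>0 * \<eta> \<le> \<alpha>\<^sub>0 * 1" using \<alpha>\<^sub>0 \<eta> by (intro mult_left_mono) auto
      then show "\<zeta> < 1" using \<alpha>\<^sub>0 by (simp add: \<zeta>_def)
    qed
    have "sqrt \<zeta> * x \<le> sqrt \<zeta> * 1" using x \<zeta> by (intro mult_left_mono) auto
    also have "\<dots> < 1" using \<zeta> by (simp add: real_sqrt_lt_1_iff)
    finally have lt: "\<bar>sqrt \<zeta> * x\<bar> < 1" using x \<zeta> by simp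
    have eq: "drift_primitive \<alpha>\<^sub>0 \<eta> = (\<lambda>x. artanh (sqrt \<zeta> * x) / (sqrt \<zeta> * (1 + \<alpha>\<^sub>0)))"
      using False by (simp add: drift_primitive_def fun_eq_iff flip: \<zeta>_def)
    have "((\<lambda>x. artanh (sqrt \<zeta> * x)) has_real_derivative 1 / (1 - (sqrt \<zeta> * x)\<^sup>2) * sqrt \<zeta>) (at x)"
      by (rule DERIV_chain2[where g="(*) (sqrt \<zeta>)" and x=x, OF artanh_real_has_field_derivative[OF lt]]) (auto intro!: derivative_eq_intros)
    then have "((\<lambda>x. artanh (sqrt \<zeta> * x) / (sqrt \<zeta> * (1 + \<alpha>\<^sub>0))) has_real_derivative
        1 / (1 - (sqrt \<zeta> * x)\<^sup>2) * sqrt \<zeta> / (sqrt \<zeta> * (1 + \<alpha>\<^sub>0))) (at x)"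
      by (rule DERIV_cdivide)
    also have "1 / (1 - (sqrt \<zeta> * x)\<^sup>2) * sqrt \<zeta> / (sqrt \<zeta> * (1 + \<alpha>\<^sub>0)) = 1 / (1 + \<alpha>\<^sub>0 * (1 - \<eta> * x\<^sup>2))"
      unfolding den using \<zeta> by (simp add: power_mult_distrib)
    finally show ?thesis unfolding eq .
  qed
qed

lemma thinning_region_cong:
  assumes "\<And>s. 0 < s \<Longrightarrow> s \<le> t \<Longrightarrow> l s = l' s"
  shows "thinning_region l t = thinning_region l' t"
  using assms by (auto simp: thinning_region_def)

text \<open>The error bound does not involve T, so it disappears after division by the horizon, for
  every eta in [0, 1] including 0.\<close>

lemma price_mean_bound:
  fixes M :: "'a measure" and Np Nm :: "real \<Rightarrow> 'a \<Rightarrow> nat"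
  assumes prm: "poisson_random_measure M lborel \<pi>p" "poisson_random_measure M lborel \<pi>m"
      "indep_random_measures M lborel \<pi>p \<pi>m"
    and par: "0 \<le> \<alpha>\<^sub>0" "\<alpha>\<^sub>0 < 1" "0 < \<beta>" "0 \<le> \<mu>\<^sub>0" "0 < \<Delta>\<mu>"
    and \<eta>: "\<eta> \<in> {0..1}" and T: "0 < T" and u: "u \<in> {0<..1}"
    and hawkes: "locally_stationary_hawkes M \<pi>p \<pi>m (\<mu>\<^sub>0 + \<Delta>\<mu>) \<mu>\<^sub>0 (\<lambda>x. \<alpha>\<^sub>0 * (1 - \<eta> * x\<^sup>2)) \<beta> T Np Nm"
  shows "\<bar>(\<integral>\<omega>. price Np Nm (T * u) \<omega> - price Np Nm 0 \<omega> \<partial>M) - T * \<Delta>\<mu> * drift_primitive \<alpha>\<^sub>0 \<eta> u\<bar> \<le> 3 * \<Delta>\<mu> / \<beta>"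
proof -
  \<comment> \<open>Clamping the argument makes the bounds on the kernel global without changing the process.\<close>
  define cl :: "real \<Rightarrow> real" where "cl x = max 0 (min 1 x)" for x
  define \<alpha> where "\<alpha> x = \<alpha>\<^sub>0 * (1 - \<eta> * (cl x)\<^sup>2)" for x
  have cl: "0 \<le> cl x" "cl x \<le> 1" "x \<in> {0..1} \<Longrightarrow> cl x = x" for x by (auto simp: cl_def)
  have \<eta>cl: "0 \<le> \<eta> * (cl x)\<^sup>2" "\<eta> * (cl x)\<^sup>2 \<le> 1" for x
    using \<eta> cl(1,2)[of x] by (auto intro!: mult_le_one power_le_one)
  have \<alpha>01: "0 \<le> \<alpha> x" "\<alpha> x \<le> 1" for x
  proof -
    show "0 \<le> \<alpha> x" unfolding \<alpha>_def using \<eta>cl[of x] par by (intro mult_nonneg_nonneg) auto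
    show "\<alpha> x \<le> 1" unfolding \<alpha>_def using \<eta>cl[of x] par by (intro mult_le_one) auto
  qed
  have \<alpha>_diff: "0 \<le> \<alpha> x - \<alpha> x'" "\<alpha> x - \<alpha> x' \<le> 2 * (x' - x)" if "0 \<le> x" "x \<le> x'" "x' \<le> 1" for x x'
  proof -
    \<comment> \<open>Origin of the Lipschitz constant 2: x' + x is at most 2 on [0, 1], and alpha_0
      eta is at most 1.\<close>
    have eq: "\<alpha> x - \<alpha> x' = (\<alpha>\<^sub>0 * \<eta>) * ((x' + x) * (x' - x))"
      using that by (simp add: \<alpha>_def cl power2_eq_square algebra_simps)
    show "0 \<le> \<alpha> x - \<alpha> x'" unfolding eq using that par \<eta> by (intro mult_nonneg_nonneg) auto
    have "(\<alpha>\<^sub>0 * \<eta>) * ((x' + x) * (x' - x)) \<le> 1 * (2 * (x' - x))"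
      using that par \<eta> by (intro mult_mono mult_le_one) auto
    then show "\<alpha> x - \<alpha> x' \<le> 2 * (x' - x)" unfolding eq by simp
  qed
  interpret p: poisson_random_measure M lborel \<pi>p by fact
  interpret p': poisson_random_measure M lborel \<pi>m by fact
  interpret hawkes_prms \<alpha> \<beta> T M \<pi>p \<pi>m "\<mu>\<^sub>0 + \<Delta>\<mu>" \<mu>\<^sub>0
  proof
    show "\<alpha> x' \<le> \<alpha> x" if "0 \<le> x" "x \<le> x'" "x' \<le> 1" for x x' using \<alpha>_diff(1)[OF that] by simp
    show "isCont \<alpha> x" for x unfolding \<alpha>_def cl_def by (intro continuous_intros)
  qed (use prm par T \<alpha>01 in auto)
  have region_eq: "thinning_region (intensity \<mu> (\<lambda>x. \<alpha>\<^sub>0 * (1 - \<eta> * x\<^sup>2)) \<beta> T N) t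
      = thinning_region (intensity \<mu> \<alpha> \<beta> T N) t" if "t \<in> {0..T}" for \<mu> N t
  proof (rule thinning_region_cong)
    fix s assume "0 < s" "s \<le> t"
    then have "cl (s / T) = s / T" using that T by (intro cl(3)) auto
    then show "intensity \<mu> (\<lambda>x. \<alpha>\<^sub>0 * (1 - \<eta> * x\<^sup>2)) \<beta> T N s = intensity \<mu> \<alpha> \<beta> T N s"
      by (simp add: intensity_def \<alpha>_def)
  qed
  have thin: "AE \<omega> in M. \<forall>t\<in>{0..T}.
      of_nat (Np t \<omega>) = emeasure (\<pi>p \<omega>) (thinning_region (intensity (\<mu>\<^sub>0 + \<Delta>\<mu>) \<alpha> \<beta> T (\<lambda>s. Nm s \<omega>)) t) \<and>
      of_nat (Nm t \<omega>) = emeasure (\<pi>m \<omega>) (thinning_region (intensity \<mu>\<^sub>0 \<alpha> \<beta> T (\<lambda>s. Np s \<omega>)) t)"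
    using hawkes[unfolded locally_stationary_hawkes_def, THEN conjunct2, THEN conjunct2]
  proof eventually_elim
    case (elim \<omega>)
    show ?case
    proof
      fix t assume t: "t \<in> {0..T}"
      from bspec[OF elim t] show "of_nat (Np t \<omega>) =
          emeasure (\<pi>p \<omega>) (thinning_region (intensity (\<mu>\<^sub>0 + \<Delta>\<mu>) \<alpha> \<beta> T (\<lambda>s. Nm s \<omega>)) t) \<and>
        of_nat (Nm t \<omega>) = emeasure (\<pi>m \<omega>) (thinning_region (intensity \<mu>\<^sub>0 \<alpha> \<beta> T (\<lambda>s. Np s \<omega>)) t)"
        unfolding region_eq[OF t] .
    qed
  qed
  have \<tau>: "0 < T * u" "T * u \<le> T" using T u by auto
  have meas: "Np t \<in> measurable M (count_space UNIV)" "Nm t \<in> measurable M (count_space UNIV)"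
    if "t \<in> {0..T}" for t
    using hawkes that by (auto simp: locally_stationary_hawkes_def)
  \<comment> \<open>a / (1 + a) is 1-Lipschitz in a \<ge> 0, so it inherits the constant of
    \<open>\<alpha>\<close>.\<close>
  have lip: "\<bar>\<alpha> x / (1 + \<alpha> x) - \<alpha> x' / (1 + \<alpha> x')\<bar> \<le> 2 * (x' - x)"
    if "0 \<le> x" "x \<le> x'" "x' \<le> 1" for x x'
  proof -
    have "\<alpha> x / (1 + \<alpha> x) - \<alpha> x' / (1 + \<alpha> x') = (\<alpha> x - \<alpha> x') / ((1 + \<alpha> x) * (1 + \<alpha> x'))"
      using \<alpha>01(1)[of x] \<alpha>01(1)[of x'] by (simp add: field_simps)
    also have "\<bar>\<dots>\<bar> \<le> (\<alpha> x - \<alpha> x') / 1"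
      unfolding abs_divide using \<alpha>01(1)[of x] \<alpha>01(1)[of x'] \<alpha>_diff(1)[OF that]
      by (intro frac_le) (auto simp: abs_mult intro!: mult_ge1_I)
    finally show ?thesis using \<alpha>_diff(2)[OF that] by simp
  qed
  have F: "(drift_primitive \<alpha>\<^sub>0 \<eta> has_real_derivative 1 / (1 + \<alpha> x)) (at x)" if "x \<in> {0..1}" for x
    using drift_primitive_deriv[OF par(1) \<eta> that] that
    by (simp add: \<alpha>_def cl(3))
  have F0: "drift_primitive \<alpha>\<^sub>0 \<eta> 0 = 0" by (simp add: drift_primitive_def Let_def)
  have Tu: "T * u \<in> {0..T}" using \<tau> by simp
  note B = mean_difference_bound[OF \<tau> meas[OF Tu] thin _ refl lip F0 F]
  have int: "integrable M (\<lambda>\<omega>. real (Np (T * u) \<omega>))" "integrable M (\<lambda>\<omega>. real (Nm (T * u) \<omega>))"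
    using B(1,2) par by auto
  \<comment> \<open>The counts at time 0 vanish only almost surely, hence the passage through
    \<open>integral_cong_AE\<close>.\<close>
  have zero: "AE \<omega> in M. Np 0 \<omega> = 0 \<and> Nm 0 \<omega> = 0"
    using thin
  proof eventually_elim
    case (elim \<omega>)
    have "thinning_region l 0 = {}" for l by (auto simp: thinning_region_def)
    then show ?case using bspec[OF elim, of 0] T by simp
  qed
  note [measurable] = meas[OF Tu] meas[of 0, simplified, OF less_imp_le[OF T]]
  have "(\<integral>\<omega>. price Np Nm (T * u) \<omega> - price Np Nm 0 \<omega> \<partial>M)
      = (\<integral>\<omega>. real (Np (T * u) \<omega>) - real (Nm (T * u) \<omega>) \<partial>M)"
  proof (rule integral_cong_AE)
    show "AE \<omega> in M. price Np Nm (T * u) \<omega> - price Np Nm 0 \<omega> = real (Np (T * u) \<omega>) - real (Nm (T * u) \<omega>)"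
      using zero by eventually_elim (simp add: price_def)
  qed (unfold price_def, measurable)
  also have "\<dots> = (\<integral>\<omega>. real (Np (T * u) \<omega>) \<partial>M) - (\<integral>\<omega>. real (Nm (T * u) \<omega>) \<partial>M)"
    by (rule Bochner_Integration.integral_diff[OF int])
  finally show ?thesis using B(3) par T by simp
qed

theorem proposition2:
  fixes M :: "'a measure"
    and \<pi>p \<pi>m :: "'a \<Rightarrow> (real \<times> real) measure"
    and \<alpha>\<^sub>0 \<beta> \<mu>\<^sub>0 \<Delta>\<mu> u \<eta> :: real
    and \<alpha> :: "real \<Rightarrow> real \<Rightarrow> real"
    and Np Nm :: "real \<Rightarrow> real \<Rightarrow> real \<Rightarrow> 'a \<Rightarrow> nat"
    and P :: "real \<Rightarrow> real \<Rightarrow> real \<Rightarrow> 'a \<Rightarrow> real"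
  assumes "poisson_random_measure M lborel \<pi>p"
    and "poisson_random_measure M lborel \<pi>m"
    and "indep_random_measures M lborel \<pi>p \<pi>m"
    and "0 \<le> \<alpha>\<^sub>0" "\<alpha>\<^sub>0 < 1" "0 < \<beta>" "0 \<le> \<mu>\<^sub>0" "0 < \<Delta>\<mu>"
  defines "\<alpha> \<equiv> \<lambda>\<eta> x. \<alpha>\<^sub>0 * (1 - \<eta> * x\<^sup>2)"
  assumes "\<And>\<eta> T. \<eta> \<in> {0..1} \<Longrightarrow> 0 < T \<Longrightarrow>
      locally_stationary_hawkes M \<pi>p \<pi>m (\<mu>\<^sub>0 + \<Delta>\<mu>) \<mu>\<^sub>0 (\<alpha> \<eta>) \<beta> T (Np \<eta> T) (Nm \<eta> T)"
  defines "P \<equiv> \<lambda>\<eta> T. price (Np \<eta> T) (Nm \<eta> T)"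
  assumes "u \<in> {0<..1}" and "\<eta> \<in> {0..1}"
  shows "((\<lambda>T. (\<integral>\<omega>. P \<eta> T (T * u) \<omega> - P \<eta> T 0 \<omega> \<partial>M) / (\<integral>\<omega>. P 0 T (T * u) \<omega> - P 0 T 0 \<omega> \<partial>M))
    \<longlongrightarrow> (let \<zeta>\<^sub>0 = \<alpha>\<^sub>0 * \<eta> / (1 + \<alpha>\<^sub>0)
        in if \<zeta>\<^sub>0 = 0 then 1 else artanh (sqrt \<zeta>\<^sub>0 * u) / (sqrt \<zeta>\<^sub>0 * u))) at_top"
proof -
  define E where "E \<theta> T = (\<integral>\<omega>. P \<theta> T (T * u) \<omega> - P \<theta> T 0 \<omega> \<partial>M)" for \<theta> T
  \<comment> \<open>Stated for a general parameter, since the denominator is the same quantity at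
    parameter 0.\<close>
  have lim: "((\<lambda>T. E \<theta> T / T) \<longlongrightarrow> \<Delta>\<mu> * drift_primitive \<alpha>\<^sub>0 \<theta> u) at_top" if \<theta>: "\<theta> \<in> {0..1}" for \<theta>
  proof -
    have bound: "\<bar>E \<theta> T - T * \<Delta>\<mu> * drift_primitive \<alpha>\<^sub>0 \<theta> u\<bar> \<le> 3 * \<Delta>\<mu> / \<beta>" if T: "0 < T" for T
      unfolding E_def P_def
      using price_mean_bound[OF assms(1-8) \<theta> T assms(12)] assms(10)[OF \<theta> T] by (simp add: \<alpha>_def)
    have "\<forall>\<^sub>F T in at_top. norm (E \<theta> T / T - \<Delta>\<mu> * drift_primitive \<alpha>\<^sub>0 \<theta> u) \<le> 3 * \<Delta>\<mu> / \<beta> / T"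
      using eventually_gt_at_top[of 0]
    proof eventually_elim
      case (elim T)
      have "E \<theta> T / T - \<Delta>\<mu> * drift_primitive \<alpha>\<^sub>0 \<theta> u = (E \<theta> T - T * \<Delta>\<mu> * drift_primitive \<alpha>\<^sub>0 \<theta> u) / T"
        using elim by (simp add: field_simps)
      then show ?case
        using elim divide_right_mono[OF bound[OF elim], of T] by (simp only: real_norm_def abs_divide) simp
    qed
    moreover have "((\<lambda>T. 3 * \<Delta>\<mu> / \<beta> / T) \<longlongrightarrow> 0) at_top" by real_asymp
    ultimately have "((\<lambda>T. E \<theta> T / T - \<Delta>\<mu> * drift_primitive \<alpha>\<^sub>0 \<theta> u) \<longlongrightarrow> 0) at_top"
      by (rule Lim_null_comparison)
    then show ?thesis by (simp add: LIM_zero_iff)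
  qed
  have F0: "drift_primitive \<alpha>\<^sub>0 0 u = u / (1 + \<alpha>\<^sub>0)" by (simp add: drift_primitive_def)
  \<comment> \<open>Dividing both means by T gives each a finite limit; that of the denominator is
    positive because \<open>\<Delta>\<mu>\<close> and \<open>u\<close> are.\<close>
  have "((\<lambda>T. (E \<eta> T / T) / (E 0 T / T)) \<longlongrightarrow>
      (\<Delta>\<mu> * drift_primitive \<alpha>\<^sub>0 \<eta> u) / (\<Delta>\<mu> * drift_primitive \<alpha>\<^sub>0 0 u)) at_top"
    using assms by (intro tendsto_divide lim) (auto simp: F0)
  also have "(\<Delta>\<mu> * drift_primitive \<alpha>\<^sub>0 \<eta> u) / (\<Delta>\<mu> * drift_primitive \<alpha>\<^sub>0 0 u)
      = (let \<zeta>\<^sub>0 = \<alpha>\<^sub>0 * \<eta> / (1 + \<alpha>\<^sub>0)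
        in if \<zeta>\<^sub>0 = 0 then 1 else artanh (sqrt \<zeta>\<^sub>0 * u) / (sqrt \<zeta>\<^sub>0 * u))"
    using assms unfolding F0 by (simp add: drift_primitive_def Let_def)
  finally show ?thesis
    by (rule Lim_transform_eventually)
       (use eventually_gt_at_top[of 0] in \<open>auto elim!: eventually_mono simp: E_def\<close>)
qed

end
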